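(* Let the scalar field be $\mathbb{K}=\mathbb{R}$ or $\mathbb{C}$. Let $w$ be an admissible sequence such that $w\in\ell_m$ for some $m\in\mathbb{N}$, and let $M$ be the smallest natural number such that $w\in\ell_M$. Then, for every $N\in\mathbb{N}$, the set $\mathcal{NAP}(^Nd_*(w,1);\ell_M)$ is not dense in $\mathcal{P}(^Nd_*(w,1);\ell_M)$.
   Context: A sequence $w=(w_i)_{i\in\mathbb{N}}$ is admissible if it is a decreasing (non-increasing) sequence of nonnegative real numbers with $w_1=1$, $\lim_i w_i=0$ and $\sum_i w_i=\infty$. Put $W(n)=\sum_{i=1}^nw_i$. For a bounded scalar sequence $x=(x(i))_i$, $x^*=(x^*(i))_i$ denotes the decreasing rearrangement of $(|x(i)|)_i$. The space $d^*(w,1)$ consists of all bounded sequences $x$ of scalars with $\|x\|_W:=\sup_n\frac{\sum_{i=1}^nx^*(i)}{W(n)}<\infty$, with norm $\|\cdot\|_W$; $d_*(w,1)$ (the predual of the Lorentz sequence space $d(w,1)$) is the closed subspace of those $x$ with $\lim_{n\to\infty}\frac{\sum_{i=1}^nx^*(i)}{W(n)}=0$. $\mathcal{P}(^NX;Y)$ is the Banach space of continuous $N$-homogeneous polynomials $P:X\to Y$ (i.e. $P(x)=\Phi(x,\dots,x)$ for some continuous $N$-linear $\Phi:X\times\cdots\times X\to Y$) with norm $\|P\|=\sup_{x\in B_X}\|P(x)\|$, where $B_X$ is the closed unit ball. $\mathcal{NAP}(^NX;Y)$ is the set of those $P\in\mathcal{P}(^NX;Y)$ that attain their norm, i.e.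 for which there is $a\in B_X$ with $\|P(a)\|=\|P\|$. *)

theory Defs
  imports Complex_Main "HOL-Library.FuncSet"
begin

text \<open>
  Sequences are indexed from \<open>0\<close>, so \<open>w 0\<close> is the first weight.  Sequence spaces over the scalar
  field \<open>'a\<close> are given by a carrier set of functions \<open>nat \<Rightarrow> 'a\<close> and a norm function that is only
  meaningful on the carrier; the vector operations are pointwise.
\<close>

definition admissible :: "(nat \<Rightarrow> real) \<Rightarrow> bool" where
  "admissible w \<longleftrightarrow>
     decseq w \<and> (\<forall>i. 0 \<le> w i) \<and> w 0 = 1 \<and> w \<longlonglongrightarrow> 0 \<and> \<not> summable w"

definition W :: "(nat \<Rightarrow> real) \<Rightarrow> nat \<Rightarrow> real" where
  "W w n = (\<Sum>i<n. w i)"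

text \<open>
  For a bounded sequence, the term at position \<open>n\<close> (from \<open>0\<close>) is the infimum of the levels that
  are exceeded in modulus by at most \<open>n\<close> terms.  Finiteness has to be required separately because
  \<open>card\<close> of an infinite set is \<open>0\<close>.
\<close>
definition decr_rearr :: "(nat \<Rightarrow> 'a::real_normed_field) \<Rightarrow> nat \<Rightarrow> real" where
  "decr_rearr x n =
     Inf {s. 0 \<le> s \<and> finite {i. s < norm (x i)} \<and> card {i. s < norm (x i)} \<le> n}"

definition W_ratio :: "(nat \<Rightarrow> real) \<Rightarrow> (nat \<Rightarrow> 'a::real_normed_field) \<Rightarrow> nat \<Rightarrow> real" where
  "W_ratio w x n = (\<Sum>i<n. decr_rearr x i) / W w n"

definition norm_W :: "(nat \<Rightarrow> real) \<Rightarrow> (nat \<Rightarrow> 'a::real_normed_field) \<Rightarrow> real" where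
  "norm_W w x = (SUP n\<in>{1..}. W_ratio w x n)"

definition d_upper :: "(nat \<Rightarrow> real) \<Rightarrow> (nat \<Rightarrow> 'a::real_normed_field) set" where
  "d_upper w = {x. Bseq x \<and> bdd_above (W_ratio w x ` {1..})}"

definition d_lower :: "(nat \<Rightarrow> real) \<Rightarrow> (nat \<Rightarrow> 'a::real_normed_field) set" where
  "d_lower w = {x \<in> d_upper w. W_ratio w x \<longlonglongrightarrow> 0}"

definition lp_space :: "nat \<Rightarrow> (nat \<Rightarrow> 'a::real_normed_field) set" where
  "lp_space p = {y. summable (\<lambda>i. norm (y i) ^ p)}"

definition lp_norm :: "nat \<Rightarrow> (nat \<Rightarrow> 'a::real_normed_field) \<Rightarrow> real" where
  "lp_norm p y = root p (\<Sum>i. norm (y i) ^ p)"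

text \<open>
  An \<open>N\<close>-tuple in \<open>X\<close> is an element of \<open>{..<N} \<rightarrow>\<^sub>E X\<close>; continuity refers to the product of the
  norm topologies.
\<close>
definition multilinear_on ::
  "nat \<Rightarrow> (nat \<Rightarrow> 'a::real_normed_field) set \<Rightarrow> (nat \<Rightarrow> 'a) set \<Rightarrow>
    ((nat \<Rightarrow> nat \<Rightarrow> 'a) \<Rightarrow> nat \<Rightarrow> 'a) \<Rightarrow> bool" where
  "multilinear_on N X Y \<Phi> \<longleftrightarrow>
     \<Phi> \<in> ({..<N} \<rightarrow>\<^sub>E X) \<rightarrow> Y \<and>
     (\<forall>a \<in> {..<N} \<rightarrow>\<^sub>E X. \<forall>j<N. \<forall>u\<in>X. \<forall>v\<in>X.
        \<Phi> (a(j := (\<lambda>i. u i + v i))) = (\<lambda>i. \<Phi> (a(j := u)) i + \<Phi> (a(j := v)) i)) \<and>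
     (\<forall>a \<in> {..<N} \<rightarrow>\<^sub>E X. \<forall>j<N. \<forall>u\<in>X. \<forall>c.
        \<Phi> (a(j := (\<lambda>i. c * u i))) = (\<lambda>i. c * \<Phi> (a(j := u)) i))"

definition continuous_multi_on ::
  "nat \<Rightarrow> (nat \<Rightarrow> 'a::real_normed_field) set \<Rightarrow> ((nat \<Rightarrow> 'a) \<Rightarrow> real) \<Rightarrow> ((nat \<Rightarrow> 'a) \<Rightarrow> real) \<Rightarrow>
    ((nat \<Rightarrow> nat \<Rightarrow> 'a) \<Rightarrow> nat \<Rightarrow> 'a) \<Rightarrow> bool" where
  "continuous_multi_on N X nX nY \<Phi> \<longleftrightarrow>
     (\<forall>a \<in> {..<N} \<rightarrow>\<^sub>E X. \<forall>e>0. \<exists>d>0. \<forall>b \<in> {..<N} \<rightarrow>\<^sub>E X.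
        (\<forall>j<N. nX (\<lambda>i. b j i - a j i) < d) \<longrightarrow> nY (\<lambda>i. \<Phi> b i - \<Phi> a i) < e)"

text \<open>
  Polynomials are extensional functions on \<open>X\<close>, so that equal polynomials are equal functions.
\<close>
definition hom_polys ::
  "nat \<Rightarrow> (nat \<Rightarrow> 'a::real_normed_field) set \<Rightarrow> ((nat \<Rightarrow> 'a) \<Rightarrow> real) \<Rightarrow>
    (nat \<Rightarrow> 'a) set \<Rightarrow> ((nat \<Rightarrow> 'a) \<Rightarrow> real) \<Rightarrow> ((nat \<Rightarrow> 'a) \<Rightarrow> nat \<Rightarrow> 'a) set" where
  "hom_polys N X nX Y nY =
     {P. \<exists>\<Phi>. multilinear_on N X Y \<Phi> \<and> continuous_multi_on N X nX nY \<Phi> \<and>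
             P = (\<lambda>x\<in>X. \<Phi> (\<lambda>j\<in>{..<N}. x))}"

definition unit_ball ::
  "(nat \<Rightarrow> 'a::real_normed_field) set \<Rightarrow> ((nat \<Rightarrow> 'a) \<Rightarrow> real) \<Rightarrow> (nat \<Rightarrow> 'a) set" where
  "unit_ball X nX = {x \<in> X. nX x \<le> 1}"

definition poly_norm ::
  "(nat \<Rightarrow> 'a::real_normed_field) set \<Rightarrow> ((nat \<Rightarrow> 'a) \<Rightarrow> real) \<Rightarrow> ((nat \<Rightarrow> 'a) \<Rightarrow> real) \<Rightarrow>
    ((nat \<Rightarrow> 'a) \<Rightarrow> nat \<Rightarrow> 'a) \<Rightarrow> real" where
  "poly_norm X nX nY P = (SUP x\<in>unit_ball X nX. nY (P x))"

definition na_hom_polys ::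
  "nat \<Rightarrow> (nat \<Rightarrow> 'a::real_normed_field) set \<Rightarrow> ((nat \<Rightarrow> 'a) \<Rightarrow> real) \<Rightarrow>
    (nat \<Rightarrow> 'a) set \<Rightarrow> ((nat \<Rightarrow> 'a) \<Rightarrow> real) \<Rightarrow> ((nat \<Rightarrow> 'a) \<Rightarrow> nat \<Rightarrow> 'a) set" where
  "na_hom_polys N X nX Y nY =
     {P \<in> hom_polys N X nX Y nY. \<exists>a\<in>unit_ball X nX. nY (P a) = poly_norm X nX nY P}"

definition na_dense ::
  "nat \<Rightarrow> (nat \<Rightarrow> 'a::real_normed_field) set \<Rightarrow> ((nat \<Rightarrow> 'a) \<Rightarrow> real) \<Rightarrow>
    (nat \<Rightarrow> 'a) set \<Rightarrow> ((nat \<Rightarrow> 'a) \<Rightarrow> real) \<Rightarrow> bool" where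
  "na_dense N X nX Y nY \<longleftrightarrow>
     (\<forall>P \<in> hom_polys N X nX Y nY. \<forall>e>0. \<exists>Q \<in> na_hom_polys N X nX Y nY.
        poly_norm X nX nY (\<lambda>x i. P x i - Q x i) < e)"

end

theory Submission
  imports Defs "HOL-Analysis.Inner_Product"
begin

text \<open>
  The polynomial \<open>P x = x\<^sub>0\<^bsup>N-1\<^esup> x\<close> maps into \<open>\<ell>\<^sub>M\<close> because \<open>w\<close> does. Suppose that \<open>Q\<close> is close to \<open>P\<close> and
  attains its norm at \<open>a\<close>. In the unit ball of the predual one may move from \<open>a\<close> to \<open>a + t e\<^sub>n\<close> for
  all small \<open>t\<close> and all large \<open>n\<close>. The norm of \<open>\<ell>\<^sub>M\<close> is uniformly convex of power type \<open>M\<close>, so if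
  \<open>\<psi>\<close> supports the ball at \<open>Q a\<close>, then \<open>-\<psi>(Q(a + t e\<^sub>n) - Q a)\<close> is at least a fixed multiple of
  \<open>\<bar>t\<bar>\<^sup>M\<close>. This is a polynomial in \<open>t\<close>. Its coefficients of order \<open>k < M\<close> tend to \<open>0\<close> as \<open>n\<close> grows,
  for otherwise averaging over signs would bound the partial sums of \<open>\<Sum>w\<^sub>i\<^sup>k\<close>. Its coefficients of
  order \<open>k \<ge> M \<ge> 2\<close> vanish for \<open>P\<close>, hence are small for \<open>Q\<close>. The argument uses real \<open>t\<close> only and so
  covers both scalar fields at once.
\<close>

section \<open>Inequalities\<close>

text \<open>The order of choice shapes the estimates. The distance \<open>e\<close> must be fixed
  before \<open>Q\<close> is known, while the admissible step \<open>\<delta>\<close> depends on the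
  point \<open>a\<close> at which \<open>Q\<close> attains its norm. Hence the gain, and every error
  that survives the limit in n, must scale like \<open>\<delta> ^ M\<close>. Uniform convexity
  yields a gain of that order, provided |a 0| ^ (N - 1) is bounded below by some
  \<open>\<kappa>\<close> independent of \<open>Q\<close>. It is: \<open>Q\<close> at the unit
  vector of index 0 has norm at least 1/2, so \<open>Q a\<close> does too, whereas
  \<open>Q a\<close> is controlled by |a 0| ^ (N - 1) up to a small error. Terms of order k >= M
  cost at most a multiple of \<open>e * \<delta> ^ M\<close>. Terms of order k < M are of size
  \<open>\<delta> ^ k\<close> and receive no help from \<open>e\<close>; they are removed by letting
  n grow with \<open>\<delta>\<close> fixed. The linear coefficient of the polynomial P does not
  vanish, so order 1 has to be of this second kind. This is the role of M >= 2, which holds because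
  the weights are not summable.\<close>

lemma power_tangent_square:
  fixes x r :: real
  assumes "0 \<le> x" "0 \<le> r"
  shows "real (m + 2) * r ^ m * x\<^sup>2 \<le> 2 * x ^ (m + 2) + real m * r ^ (m + 2)"
proof (induction m)
  case 0
  then show ?case by (simp add: power2_eq_square)
next
  case (Suc m)
  \<comment> \<open>The claim is the tangent inequality at r^2 for the convex function s^((m+2)/2)
    of s = x^2. The induction expresses the slack for \<open>Suc m\<close> as x times the slack for
    m plus an explicit nonnegative term.\<close>
  have "0 \<le> x * (2 * x ^ (m + 2) + real m * r ^ (m + 2) - real (m + 2) * r ^ m * x\<^sup>2)
      + r ^ m * ((x - r)\<^sup>2 * (real (m + 2) * x + real (m + 1) * r))"
    using Suc assms by (intro add_nonneg_nonneg mult_nonneg_nonneg) auto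
  also have "\<dots> = 2 * x ^ (Suc m + 2) + real (Suc m) * r ^ (Suc m + 2)
      - real (Suc m + 2) * r ^ Suc m * x\<^sup>2"
    by (simp add: algebra_simps power2_eq_square)
  finally show ?case by simp
qed

text \<open>Expand the square of the norm of s + t, drop the square of the norm of t, and use the
  previous tangent inequality with x = |s + t| and r = |s|.\<close>

lemma norm_power_tangent:
  fixes s t :: "'a::real_inner"
  shows "norm s ^ (m + 2) + real (m + 2) * norm s ^ m * inner s t \<le> norm (s + t) ^ (m + 2)"
proof -
  have sq: "(norm (s + t))\<^sup>2 = (norm s)\<^sup>2 + 2 * inner s t + (norm t)\<^sup>2"
    by (simp add: power2_norm_eq_inner inner_simps inner_commute)
  have "real (m + 2) * norm s ^ m * ((norm s)\<^sup>2 + 2 * inner s t)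
      \<le> real (m + 2) * norm s ^ m * (norm (s + t))\<^sup>2"
    unfolding sq by (intro mult_left_mono) auto
  also have "\<dots> \<le> 2 * norm (s + t) ^ (m + 2) + real m * norm s ^ (m + 2)"
    by (rule power_tangent_square) auto
  finally show ?thesis by (simp add: algebra_simps power2_eq_square)
qed

text \<open>In the plane the l_p norm is at most the l_2 norm for p >= 2: each of the two numbers is
  at most r, so m of its factors may be replaced by r.\<close>

lemma power_add_le_power_sqrt:
  fixes \<alpha> \<beta> r :: real
  assumes "0 \<le> \<alpha>" "0 \<le> \<beta>" "0 \<le> r" "\<alpha>\<^sup>2 + \<beta>\<^sup>2 = r\<^sup>2"
  shows "\<alpha> ^ (m + 2) + \<beta> ^ (m + 2) \<le> r ^ (m + 2)"
proof -
  have "\<alpha>\<^sup>2 \<le> r\<^sup>2" "\<beta>\<^sup>2 \<le> r\<^sup>2"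
    using assms(4) zero_le_power2[of \<alpha>] zero_le_power2[of \<beta>] by linarith+
  then have "\<alpha> \<le> r" "\<beta> \<le> r"
    using assms power2_le_imp_le by blast+
  then have "\<alpha> ^ m * \<alpha>\<^sup>2 \<le> r ^ m * \<alpha>\<^sup>2" "\<beta> ^ m * \<beta>\<^sup>2 \<le> r ^ m * \<beta>\<^sup>2"
    using assms by (intro mult_right_mono power_mono; simp)+
  then have "\<alpha> ^ m * \<alpha>\<^sup>2 + \<beta> ^ m * \<beta>\<^sup>2 \<le> r ^ m * r\<^sup>2"
    using assms(4) by (metis add_mono distrib_left)
  then show ?thesis by (simp only: power_add)
qed

lemma clarkson_inequality:
  fixes x y :: "'a::real_inner"
  shows "2 * norm ((1/2) *\<^sub>R (x + y)) ^ (m + 2) + 2 * norm ((1/2) *\<^sub>R (x - y)) ^ (m + 2)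
    \<le> norm x ^ (m + 2) + norm y ^ (m + 2)"
proof -
  \<comment> \<open>The quadratic mean of the two norms. By the parallelogram identity it is also
    the Euclidean length of the pair formed by the norms of the half sum and the half
    difference.\<close>
  define r where "r = sqrt (((norm x)\<^sup>2 + (norm y)\<^sup>2) / 2)"
  have r0: "0 \<le> r" and r2: "r\<^sup>2 = ((norm x)\<^sup>2 + (norm y)\<^sup>2) / 2"
    by (auto simp: r_def)
  have "(norm ((1/2) *\<^sub>R (x + y)))\<^sup>2 + (norm ((1/2) *\<^sub>R (x - y)))\<^sup>2 = r\<^sup>2"
    unfolding r2 by (simp add: power2_norm_eq_inner inner_simps inner_commute field_simps)
  then have "norm ((1/2) *\<^sub>R (x + y)) ^ (m + 2) + norm ((1/2) *\<^sub>R (x - y)) ^ (m + 2) \<le> r ^ (m + 2)"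
    by (intro power_add_le_power_sqrt) (use r0 in auto)
  \<comment> \<open>The power mean inequality, obtained by adding the tangent inequalities at r for
    both norms.\<close>
  moreover have "2 * r ^ (m + 2) \<le> norm x ^ (m + 2) + norm y ^ (m + 2)"
  proof -
    have "real (m + 2) * r ^ m * (norm x)\<^sup>2 + real (m + 2) * r ^ m * (norm y)\<^sup>2
        = real (m + 2) * r ^ m * (2 * r\<^sup>2)"
      unfolding r2 by (simp add: algebra_simps)
    then have "real (m + 2) * r ^ m * (norm x)\<^sup>2 + real (m + 2) * r ^ m * (norm y)\<^sup>2
        = 2 * real (m + 2) * r ^ (m + 2)"
      by (simp add: power2_eq_square)
    moreover have "real (m + 2) * r ^ m * (norm x)\<^sup>2 \<le> 2 * norm x ^ (m + 2) + real m * r ^ (m + 2)"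
      "real (m + 2) * r ^ m * (norm y)\<^sup>2 \<le> 2 * norm y ^ (m + 2) + real m * r ^ (m + 2)"
      using r0 by (intro power_tangent_square; simp)+
    ultimately show ?thesis by (simp add: algebra_simps)
  qed
  ultimately show ?thesis by linarith
qed

text \<open>The tangent inequality alone gives no remainder. It is applied at the midpoint s + t/2
  only, and Clarkson's inequality for s + t and s then supplies the term in t. Its difference vector
  t/2 is the source of the constant 2 / 2^M.\<close>

lemma norm_power_uniformly_convex:
  fixes s t :: "'a::real_inner"
  assumes "2 \<le> M"
  shows "norm s ^ M + real M * (norm s ^ (M - 2) * inner s t) + 2 / 2 ^ M * norm t ^ M \<le> norm (s + t) ^ M"
proof -
  obtain m where M: "M = m + 2"
    using assms by (metis add.commute le_Suc_ex)
  have a: "norm s ^ M + real M * (norm s ^ m * inner s t) / 2 \<le> norm (s + (1/2) *\<^sub>R t) ^ M"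
    using norm_power_tangent[of s m "(1/2) *\<^sub>R t"] by (simp add: M mult_ac)
  have "(1/2) *\<^sub>R ((s + t) + s) = s + (1/2) *\<^sub>R t"
    by (simp add: algebra_simps flip: scaleR_2)
  moreover have "(1/2) *\<^sub>R ((s + t) - s) = (1/2) *\<^sub>R t"
    by simp
  ultimately have "2 * norm (s + (1/2) *\<^sub>R t) ^ M + 2 * (norm t / 2) ^ M \<le> norm (s + t) ^ M + norm s ^ M"
    using clarkson_inequality[of "s + t" s m] by (simp add: M)
  with a show ?thesis by (simp add: M power_divide)
qed

section \<open>Majorization for sums of powers\<close>

lemma power_diff_ge_tangent:
  fixes x y :: real
  assumes "0 \<le> x" "0 \<le> y"
  shows "real m * y ^ (m - 1) * (x - y) \<le> x ^ m - y ^ m"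
proof (induction m)
  case (Suc m)
  show ?case
  proof (cases m)
    case (Suc k)
    have "0 \<le> x * (x ^ m - y ^ m - real m * y ^ (m - 1) * (x - y)) + real m * y ^ (m - 1) * (x - y)\<^sup>2"
      using Suc.IH assms by (intro add_nonneg_nonneg mult_nonneg_nonneg) auto
    also have "\<dots> = x ^ Suc m - y ^ Suc m - real (Suc m) * y ^ (Suc m - 1) * (x - y)"
      by (simp add: Suc algebra_simps power2_eq_square)
    finally show ?thesis by simp
  qed simp
qed simp

text \<open>Abel summation. The induction carries the stronger lower bound by g n times the n-th
  partial sum, which survives the passage to the smaller weight \<open>g (Suc n)\<close>.\<close>

lemma sum_decreasing_weights_nonneg:
  fixes g d :: "nat \<Rightarrow> real"
  assumes "\<And>k. 0 \<le> g k" "decseq g" "\<And>n. 0 \<le> (\<Sum>k<n. d k)"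
  shows "0 \<le> (\<Sum>k<n. g k * d k)"
proof -
  have "g n * (\<Sum>k<n. d k) \<le> (\<Sum>k<n. g k * d k)"
  proof (induction n)
    case (Suc n)
    have "g (Suc n) * (\<Sum>k<Suc n. d k) \<le> g n * (\<Sum>k<Suc n. d k)"
      using assms by (intro mult_right_mono decseq_SucD)
    also have "\<dots> \<le> (\<Sum>k<Suc n. g k * d k)"
      using Suc by (simp add: algebra_simps)
    finally show ?case .
  qed simp
  moreover have "0 \<le> g n * (\<Sum>k<n. d k)"
    using assms by simp
  ultimately show ?thesis by linarith
qed

text \<open>The slopes of the tangents of the m-th power at the points y k decrease with k, so Abel
  summation applies to them with the differences v k - y k.\<close>

lemma sum_power_le_of_majorized:
  fixes y v :: "nat \<Rightarrow> real"
  assumes "\<And>k. 0 \<le> y k" "\<And>k. 0 \<le> v k" "decseq y" "\<And>n. (\<Sum>k<n. y k) \<le> (\<Sum>k<n. v k)"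
  shows "(\<Sum>k<n. y k ^ m) \<le> (\<Sum>k<n. v k ^ m)"
proof -
  have "0 \<le> (\<Sum>k<n. (real m * y k ^ (m - 1)) * (v k - y k))"
  proof (rule sum_decreasing_weights_nonneg)
    show "decseq (\<lambda>k. real m * y k ^ (m - 1))"
      using assms by (auto simp: decseq_def intro!: mult_left_mono power_mono)
  qed (use assms in \<open>auto simp: sum_subtractf\<close>)
  also have "\<dots> \<le> (\<Sum>k<n. v k ^ m - y k ^ m)"
    by (intro sum_mono power_diff_ge_tangent assms)
  finally show ?thesis by (simp add: sum_subtractf)
qed

text \<open>Replacing \<open>p(t)\<close> by \<open>p(t) - 2\<^sup>N p(t/2)\<close> removes the leading term.\<close>
lemma coefficients_bounded_by_polynomial:
  "\<exists>K\<ge>0. \<forall>(c::nat \<Rightarrow> 'v::real_normed_vector) B.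
     (\<forall>t. \<bar>t\<bar> \<le> 1 \<longrightarrow> norm (\<Sum>k\<le>N. t ^ k *\<^sub>R c k) \<le> B) \<longrightarrow> (\<forall>k\<le>N. norm (c k) \<le> K * B)"
proof (induction N)
  case 0
  show ?case
    by (intro exI[of _ 1]) (simp, metis abs_zero zero_le_one)
next
  case (Suc N)
  then obtain K where K: "K \<ge> 0"
    "\<And>(c::nat \<Rightarrow> 'v) B k. \<lbrakk>\<And>t. \<bar>t\<bar> \<le> 1 \<Longrightarrow> norm (\<Sum>k\<le>N. t ^ k *\<^sub>R c k) \<le> B; k \<le> N\<rbrakk> \<Longrightarrow> norm (c k) \<le> K * B"
    by metis
  \<comment> \<open>The combination p(t) - 2^(N+1) p(t/2) is bounded by (1 + 2^(N+1)) B, and the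
    induction hypothesis applies to it.\<close>
  define L where "L = K * (1 + 2 ^ Suc N)"
  have L: "0 \<le> L" using K by (simp add: L_def)
  have "norm (c k) \<le> (L + (1 + real (Suc N) * L)) * B"
    if B: "\<And>t. \<bar>t\<bar> \<le> 1 \<Longrightarrow> norm (\<Sum>k\<le>Suc N. t ^ k *\<^sub>R c k) \<le> B" and k: "k \<le> Suc N"
    for c :: "nat \<Rightarrow> 'v" and B k
  proof -
    have B0: "0 \<le> B"
      using order_trans[OF norm_ge_zero B[of 0]] by simp
    have low: "norm (c k) \<le> L * B" if k: "k \<le> N" for k
    proof -
      have "norm ((1 - 2 ^ (Suc N - k)) *\<^sub>R c k) \<le> K * ((1 + 2 ^ Suc N) * B)"
      proof (rule K(2)[OF _ k])
        fix t :: real assume t: "\<bar>t\<bar> \<le> 1"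
        have "(\<Sum>k\<le>N. t ^ k *\<^sub>R (1 - 2 ^ (Suc N - k)) *\<^sub>R c k)
            = (\<Sum>k\<le>Suc N. t ^ k *\<^sub>R (1 - 2 ^ (Suc N - k)) *\<^sub>R c k)"
          by simp
        also have "\<dots> = (\<Sum>k\<le>Suc N. t ^ k *\<^sub>R c k - 2 ^ Suc N *\<^sub>R ((t / 2) ^ k *\<^sub>R c k))"
        proof (rule sum.cong)
          fix k assume "k \<in> {..Suc N}"
          then have "(2::real) ^ Suc N = 2 ^ (Suc N - k) * 2 ^ k"
            by (simp only: atMost_iff flip: power_add) simp
          then have "t ^ k * (1 - 2 ^ (Suc N - k)) = t ^ k - 2 ^ Suc N * (t / 2) ^ k"
            by (simp add: power_divide algebra_simps)
          then show "t ^ k *\<^sub>R (1 - 2 ^ (Suc N - k)) *\<^sub>R c k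
              = t ^ k *\<^sub>R c k - 2 ^ Suc N *\<^sub>R ((t / 2) ^ k *\<^sub>R c k)"
            by (simp add: algebra_simps flip: scaleR_left_diff_distrib)
        qed simp
        also have "\<dots> = (\<Sum>k\<le>Suc N. t ^ k *\<^sub>R c k) - 2 ^ Suc N *\<^sub>R (\<Sum>k\<le>Suc N. (t / 2) ^ k *\<^sub>R c k)"
          by (simp only: sum_subtractf scaleR_right.sum)
        also have "norm \<dots> \<le> B + 2 ^ Suc N * B"
          using t by (intro order_trans[OF norm_triangle_ineq4] add_mono B)
            (auto intro!: mult_left_mono B simp del: sum.atMost_Suc)
        finally show "norm (\<Sum>k\<le>N. t ^ k *\<^sub>R (1 - 2 ^ (Suc N - k)) *\<^sub>R c k) \<le> (1 + 2 ^ Suc N) * B"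
          by (simp add: algebra_simps)
      qed
      \<comment> \<open>The coefficient of order k in the combination is c k times 1 - 2^(N+1-k), a
        factor of modulus at least 1 for k <= N, so nothing is lost in recovering c k.\<close>
      moreover have "1 * norm (c k) \<le> \<bar>1 - 2 ^ (Suc N - k)\<bar> * norm (c k)"
      proof (rule mult_right_mono)
        have "(2::real) ^ 1 \<le> 2 ^ (Suc N - k)"
          using k by (intro power_increasing) auto
        then show "1 \<le> \<bar>1 - (2::real) ^ (Suc N - k)\<bar>" by simp
      qed simp
      ultimately show ?thesis by (simp add: L_def mult_ac)
    qed
    \<comment> \<open>The leading coefficient, which the combination cancels, is recovered from the
      value at t = 1.\<close>
    have "c (Suc N) = (\<Sum>k\<le>Suc N. 1 ^ k *\<^sub>R c k) - (\<Sum>k\<le>N. c k)"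
      by simp
    also have "norm \<dots> \<le> B + (\<Sum>k\<le>N. L * B)"
      by (intro order_trans[OF norm_triangle_ineq4] add_mono B sum_norm_le low) auto
    finally have "norm (c (Suc N)) \<le> (1 + real (Suc N) * L) * B"
      by (simp add: algebra_simps)
    then show ?thesis
      using low[of k] k L B0 by (cases "k = Suc N") (auto simp: distrib_right intro: order_trans add_increasing add_increasing2)
  qed
  then show ?case using L by (intro exI[of _ "L + (1 + real (Suc N) * L)"]) auto
qed

text \<open>Signs are chosen greedily: the average over the last sign loses neither the diagonal
  entry nor the previously collected terms.\<close>
lemma signs_dominating_diagonal:
  fixes A :: "'i \<Rightarrow> 'i \<Rightarrow> real"
  assumes "finite J"
  shows "\<exists>s. (\<forall>l. \<bar>s l\<bar> = 1) \<and> (\<Sum>j\<in>J. \<bar>A j j\<bar>) \<le> (\<Sum>j\<in>J. \<bar>\<Sum>l\<in>J. s l * A j l\<bar>)"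
  using assms
proof induction
  case empty
  show ?case by (rule exI[of _ "\<lambda>_. 1"]) simp
next
  case (insert p J)
  then obtain s where s: "\<And>l. \<bar>s l\<bar> = 1" "(\<Sum>j\<in>J. \<bar>A j j\<bar>) \<le> (\<Sum>j\<in>J. \<bar>\<Sum>l\<in>J. s l * A j l\<bar>)"
    by blast
  define c where "c j = (\<Sum>l\<in>J. s l * A j l)" for j
  have ext: "(\<Sum>l\<in>insert p J. (s(p := e)) l * A j l) = c j + e * A j p" for e j
    using insert by (simp add: c_def) (intro sum.cong; auto)
  have "(\<Sum>j\<in>J. 2 * \<bar>c j\<bar>) \<le> (\<Sum>j\<in>J. \<bar>c j + A j p\<bar> + \<bar>c j - A j p\<bar>)"
    by (intro sum_mono) auto
  then have "2 * (\<Sum>j\<in>insert p J. \<bar>A j j\<bar>)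
      \<le> (\<Sum>j\<in>insert p J. \<bar>c j + 1 * A j p\<bar>) + (\<Sum>j\<in>insert p J. \<bar>c j + (-1) * A j p\<bar>)"
    using insert s(2) by (simp add: sum.distrib sum_distrib_left[symmetric] c_def[symmetric])
  then obtain e where "\<bar>e\<bar> = (1::real)"
    "(\<Sum>j\<in>insert p J. \<bar>A j j\<bar>) \<le> (\<Sum>j\<in>insert p J. \<bar>c j + e * A j p\<bar>)"
    by (cases "(\<Sum>j\<in>insert p J. \<bar>A j j\<bar>) \<le> (\<Sum>j\<in>insert p J. \<bar>c j + 1 * A j p\<bar>)")
      (use that[of 1] that[of "-1"] in auto)
  then show ?case
    using s(1) by (intro exI[of _ "s(p := e)"]) (simp only: ext, auto)
qed

section \<open>Power sums and their tangent functionals\<close>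

text \<open>The p-th power of \<open>lp_norm\<close>. Working with it avoids roots, and crude
  constants such as 2^p can stand in for Minkowski's inequality.\<close>

definition lp_sum :: "nat \<Rightarrow> (nat \<Rightarrow> 'a::real_normed_field) \<Rightarrow> real" where
  "lp_sum p y = (\<Sum>i. norm (y i) ^ p)"

lemma lp_sum_nonneg: "y \<in> lp_space p \<Longrightarrow> 0 \<le> lp_sum p y"
  by (auto simp: lp_sum_def lp_space_def intro!: suminf_nonneg)

lemma lp_norm_le_iff:
  assumes "1 \<le> p" "0 \<le> t" "y \<in> lp_space p"
  shows "lp_norm p y \<le> t \<longleftrightarrow> lp_sum p y \<le> t ^ p"
proof -
  have "lp_norm p y \<le> t \<longleftrightarrow> root p (lp_sum p y) \<le> root p (t ^ p)"
    using assms by (simp add: lp_norm_def lp_sum_def real_root_power_cancel)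
  also have "\<dots> \<longleftrightarrow> lp_sum p y \<le> t ^ p"
    using assms by (intro real_root_le_iff) auto
  finally show ?thesis .
qed

lemma lp_norm_less_iff:
  assumes "1 \<le> p" "0 \<le> t" "y \<in> lp_space p"
  shows "lp_norm p y < t \<longleftrightarrow> lp_sum p y < t ^ p"
proof -
  have "lp_norm p y < t \<longleftrightarrow> root p (lp_sum p y) < root p (t ^ p)"
    using assms by (simp add: lp_norm_def lp_sum_def real_root_power_cancel)
  also have "\<dots> \<longleftrightarrow> lp_sum p y < t ^ p"
    using assms by (intro real_root_less_iff) auto
  finally show ?thesis .
qed

lemma lp_norm_le_lp_norm_iff:
  assumes "1 \<le> p"
  shows "lp_norm p x \<le> lp_norm p y \<longleftrightarrow> lp_sum p x \<le> lp_sum p y"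
  using assms by (simp add: lp_norm_def lp_sum_def)

lemma norm_power_le_lp_sum:
  assumes "y \<in> lp_space p"
  shows "norm (y i) ^ p \<le> lp_sum p y"
  using sum_le_suminf[of "\<lambda>i. norm (y i) ^ p" "{i}"] assms
  by (simp add: lp_space_def lp_sum_def)

lemma norm_add_power_le:
  fixes x y :: "'a::real_normed_vector"
  shows "norm (x + y) ^ p \<le> 2 ^ p * (norm x ^ p + norm y ^ p)"
proof -
  have "norm (x + y) ^ p \<le> (2 * max (norm x) (norm y)) ^ p"
    by (intro power_mono order_trans[OF norm_triangle_ineq]) auto
  also have "\<dots> \<le> 2 ^ p * (norm x ^ p + norm y ^ p)"
    by (auto simp: power_mult_distrib max_def)
  finally show ?thesis .
qed

lemma lp_space_I:
  fixes z :: "nat \<Rightarrow> 'a::real_normed_field"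
  assumes "\<And>i. norm (z i) ^ p \<le> f i" "summable f"
  shows "z \<in> lp_space p" "lp_sum p z \<le> suminf f"
proof -
  have s: "summable (\<lambda>i. norm (z i) ^ p)"
    by (rule summable_comparison_test'[OF assms(2), of 0]) (simp add: assms)
  then show "z \<in> lp_space p" "lp_sum p z \<le> suminf f"
    by (auto simp: lp_space_def lp_sum_def intro!: suminf_le assms)
qed

lemma lp_space_add:
  assumes "x \<in> lp_space p" "y \<in> lp_space p"
  shows "(\<lambda>i. x i + y i) \<in> lp_space p"
    and "lp_sum p (\<lambda>i. x i + y i) \<le> 2 ^ p * (lp_sum p x + lp_sum p y)"
proof -
  have s: "summable (\<lambda>i. norm (x i) ^ p)" "summable (\<lambda>i. norm (y i) ^ p)"
    using assms by (auto simp: lp_space_def)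
  then have "summable (\<lambda>i. 2 ^ p * (norm (x i) ^ p + norm (y i) ^ p))"
    by (intro summable_mult summable_add)
  from lp_space_I[OF norm_add_power_le this]
  show "(\<lambda>i. x i + y i) \<in> lp_space p"
    "lp_sum p (\<lambda>i. x i + y i) \<le> 2 ^ p * (lp_sum p x + lp_sum p y)"
    using s by (auto simp: lp_sum_def suminf_mult summable_add suminf_add)
qed

lemma lp_space_mult:
  assumes "x \<in> lp_space p"
  shows "(\<lambda>i. c * x i) \<in> lp_space p" and "lp_sum p (\<lambda>i. c * x i) = norm c ^ p * lp_sum p x"
  using assms
  by (auto simp: lp_space_def lp_sum_def norm_mult power_mult_distrib suminf_mult summable_mult)

lemma lp_space_diff:
  assumes "x \<in> lp_space p" "y \<in> lp_space p"
  shows "(\<lambda>i. x i - y i) \<in> lp_space p"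
    and "lp_sum p (\<lambda>i. x i - y i) \<le> 2 ^ p * (lp_sum p x + lp_sum p y)"
  using lp_space_add[OF assms(1) lp_space_mult(1)[OF assms(2), of "-1"]] lp_space_mult(2)[OF assms(2), of "-1"]
  by simp_all

lemma lp_space_sum:
  assumes "\<And>k. k \<in> I \<Longrightarrow> z k \<in> lp_space p" "1 \<le> p"
  shows "(\<lambda>i. \<Sum>k\<in>I. z k i) \<in> lp_space p"
  using assms
proof (induction I rule: infinite_finite_induct)
  case (insert k I)
  then show ?case
    using lp_space_add(1)[of "z k" p "\<lambda>i. \<Sum>k\<in>I. z k i"] by simp
qed (auto simp: lp_space_def power_0_left)

text \<open>Up to the factor \<open>p\<close>, the derivative of \<open>lp_sum p\<close> at \<open>u\<close> in the direction \<open>y\<close>.\<close>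
definition lp_tangent ::
  "nat \<Rightarrow> (nat \<Rightarrow> 'a) \<Rightarrow> (nat \<Rightarrow> 'a::{real_normed_field, real_inner}) \<Rightarrow> real" where
  "lp_tangent p u y = (\<Sum>i. norm (u i) ^ (p - 2) * inner (u i) (y i))"

context
  fixes p :: nat and u :: "nat \<Rightarrow> 'a::{real_normed_field, real_inner}"
  assumes p: "2 \<le> p" and u: "u \<in> lp_space p"
begin

text \<open>Cauchy-Schwarz, after which both norms are replaced by their maximum: a crude form of
  Young's inequality, enough for summability.\<close>

lemma lp_tangent_term_le:
  fixes x y :: 'a
  shows "\<bar>norm x ^ (p - 2) * inner x y\<bar> \<le> norm x ^ p + norm y ^ p"
proof -
  have "\<bar>norm x ^ (p - 2) * inner x y\<bar> \<le> norm x ^ (p - 2) * (norm x * norm y)"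
    by (auto simp: abs_mult intro!: mult_left_mono Cauchy_Schwarz_ineq2)
  also have "\<dots> \<le> max (norm x) (norm y) ^ (p - 2) * (max (norm x) (norm y) * max (norm x) (norm y))"
    by (intro mult_mono power_mono) (auto simp: le_max_iff_disj)
  also have "\<dots> = max (norm x) (norm y) ^ p"
  proof -
    have "p = (p - 2) + 2" using p by simp
    then show ?thesis by (metis power2_eq_square power_add)
  qed
  also have "\<dots> \<le> norm x ^ p + norm y ^ p"
    by (auto simp: max_def)
  finally show ?thesis .
qed

lemma lp_tangent_summable:
  assumes "y \<in> lp_space p"
  shows "summable (\<lambda>i. norm (u i) ^ (p - 2) * inner (u i) (y i))"
proof (rule summable_comparison_test')
  show "summable (\<lambda>i. norm (u i) ^ p + norm (y i) ^ p)"
    using assms u by (auto simp: lp_space_def intro!: summable_add)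
qed (use lp_tangent_term_le in auto)

lemma lp_tangent_le_sum:
  assumes "y \<in> lp_space p"
  shows "\<bar>lp_tangent p u y\<bar> \<le> lp_sum p u + lp_sum p y"
proof -
  have s: "summable (\<lambda>i. norm (u i) ^ p + norm (y i) ^ p)"
    using assms u by (auto simp: lp_space_def intro!: summable_add)
  have "norm (lp_tangent p u y) \<le> (\<Sum>i. norm (u i) ^ p + norm (y i) ^ p)"
    unfolding lp_tangent_def
    by (rule norm_suminf_le[OF _ s]) (use lp_tangent_term_le in auto)
  then show ?thesis
    using assms u by (simp add: lp_space_def lp_sum_def suminf_add)
qed

lemma lp_tangent_add:
  assumes "y \<in> lp_space p" "z \<in> lp_space p"
  shows "lp_tangent p u (\<lambda>i. y i + z i) = lp_tangent p u y + lp_tangent p u z"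
  unfolding lp_tangent_def
  by (subst suminf_add[OF lp_tangent_summable lp_tangent_summable])
    (use assms in \<open>auto simp: inner_add_right distrib_left\<close>)

lemma lp_tangent_scale:
  assumes "y \<in> lp_space p"
  shows "lp_tangent p u (\<lambda>i. of_real c * y i) = c * lp_tangent p u y"
proof -
  have "inner (u i) (of_real c * y i) = c * inner (u i) (y i)" for i
    by (metis inner_scaleR_right scaleR_conv_of_real)
  then show ?thesis
    using suminf_mult[OF lp_tangent_summable[OF assms], of c]
    by (simp add: lp_tangent_def mult_ac)
qed

lemma lp_tangent_sum:
  assumes "\<And>k. k \<in> I \<Longrightarrow> z k \<in> lp_space p"
  shows "lp_tangent p u (\<lambda>i. \<Sum>k\<in>I. z k i) = (\<Sum>k\<in>I. lp_tangent p u (z k))"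
  using assms
proof (induction I rule: infinite_finite_induct)
  case (insert k I)
  then show ?case
    using lp_tangent_add[of "z k" "\<lambda>i. \<Sum>k\<in>I. z k i"] lp_space_sum[of I z p] p by simp
qed (auto simp: lp_tangent_def)

text \<open>The estimate \<open>lp_tangent_le_sum\<close> does not scale with y. Rescaling y by 1/t
  first makes the bound proportional to t, so that a small perturbation has a small tangent
  value.\<close>

lemma lp_tangent_bound:
  assumes y: "y \<in> lp_space p" "lp_sum p y \<le> t ^ p" and t: "0 < t"
  shows "\<bar>lp_tangent p u y\<bar> \<le> t * (lp_sum p u + 1)"
proof -
  define z where "z = (\<lambda>i. of_real (inverse t) * y i)"
  have z: "z \<in> lp_space p"
    unfolding z_def by (rule lp_space_mult(1)[OF y(1)])
  have "lp_sum p z = inverse t ^ p * lp_sum p y"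
    unfolding z_def using t by (subst lp_space_mult(2)[OF y(1)]) (simp add: norm_inverse)
  also have "\<dots> \<le> inverse t ^ p * t ^ p"
    using t by (intro mult_left_mono y) auto
  also have "\<dots> = 1"
    using t by (simp flip: power_mult_distrib)
  finally have "lp_sum p z \<le> 1" .
  with lp_tangent_le_sum[OF z] have "\<bar>lp_tangent p u z\<bar> \<le> lp_sum p u + 1"
    by linarith
  moreover have "lp_tangent p u z = inverse t * lp_tangent p u y"
    unfolding z_def by (rule lp_tangent_scale[OF y(1)])
  ultimately show ?thesis
    using t by (simp add: abs_mult field_simps)
qed

text \<open>Sum the pointwise inequality over the coordinates. If u + y is no larger than u, the
  last term on the left forces the tangent value of y to be negative by a multiple of
  \<open>lp_sum p y\<close>.\<close>

lemma lp_sum_uniformly_convex: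
  assumes y: "y \<in> lp_space p"
  shows "lp_sum p u + real p * lp_tangent p u y + 2 / 2 ^ p * lp_sum p y \<le> lp_sum p (\<lambda>i. u i + y i)"
proof -
  have s: "summable (\<lambda>i. norm (u i) ^ p)" "summable (\<lambda>i. norm (y i) ^ p)"
    "summable (\<lambda>i. norm (u i + y i) ^ p)"
    using u y lp_space_add(1)[OF u y] by (auto simp: lp_space_def)
  note t = lp_tangent_summable[OF y]
  have "(\<lambda>i. norm (u i) ^ p + real p * (norm (u i) ^ (p - 2) * inner (u i) (y i))
      + 2 / 2 ^ p * norm (y i) ^ p) sums
      (lp_sum p u + real p * lp_tangent p u y + 2 / 2 ^ p * lp_sum p y)"
    unfolding lp_sum_def lp_tangent_def
    by (intro sums_add sums_mult summable_sums s t)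
  moreover have "(\<lambda>i. norm (u i + y i) ^ p) sums lp_sum p (\<lambda>i. u i + y i)"
    unfolding lp_sum_def by (intro summable_sums s)
  ultimately show ?thesis
    by (rule sums_le[rotated]) (rule norm_power_uniformly_convex[OF p])
qed

end

section \<open>The predual of the Lorentz sequence space\<close>

abbreviation levels :: "(nat \<Rightarrow> 'a::real_normed_field) \<Rightarrow> nat \<Rightarrow> real set" where
  "levels x n \<equiv> {s. 0 \<le> s \<and> finite {i. s < norm (x i)} \<and> card {i. s < norm (x i)} \<le> n}"

lemma levels_nonempty:
  assumes "Bseq x"
  shows "levels x n \<noteq> {}"
proof -
  obtain K where K: "0 < K" "\<And>i. norm (x i) \<le> K"
    using assms by (auto elim: BseqE)
  then have "{i. K < norm (x i)} = {}" by (auto simp: not_less)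
  then have "K \<in> levels x n" using K by simp
  then show ?thesis by blast
qed

lemma levels_bdd_below: "bdd_below (levels x n)"
  by (rule bdd_belowI[of _ 0]) auto

lemma decr_rearr_nonneg:
  assumes "Bseq x"
  shows "0 \<le> decr_rearr x n"
  unfolding decr_rearr_def by (rule cInf_greatest[OF levels_nonempty[OF assms]]) auto

lemma decseq_decr_rearr:
  assumes "Bseq x"
  shows "decseq (decr_rearr x)"
  unfolding decseq_def decr_rearr_def
  by (intro allI impI cInf_superset_mono levels_nonempty[OF assms] levels_bdd_below) auto

text \<open>Induction on the size of A, removing an element of least modulus. Any level below that
  modulus is exceeded on all n + 1 elements of A, hence is not a level for position n.\<close>

lemma sum_norm_power_le_decr_rearr:
  assumes "Bseq x" "finite A"
  shows "(\<Sum>i\<in>A. norm (x i) ^ m) \<le> (\<Sum>k<card A. decr_rearr x k ^ m)"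
  using assms(2)
proof (induction "card A" arbitrary: A)
  case (Suc n)
  define a where "a = arg_min_on (\<lambda>i. norm (x i)) A"
  have A: "A \<noteq> {}" using Suc by auto
  have a: "a \<in> A" "\<And>i. i \<in> A \<Longrightarrow> norm (x a) \<le> norm (x i)"
    unfolding a_def using Suc A by (auto intro: arg_min_if_finite arg_min_least)
  have "norm (x a) \<le> s" if s: "s \<in> levels x n" for s
  proof (rule ccontr)
    assume "\<not> norm (x a) \<le> s"
    then have "A \<subseteq> {i. s < norm (x i)}"
      using a(2) by force
    then have "card A \<le> n"
      using s by (auto intro: order_trans[OF card_mono])
    with Suc show False by simp
  qed
  then have "norm (x a) \<le> decr_rearr x n"
    unfolding decr_rearr_def by (intro cInf_greatest levels_nonempty assms) auto
  then have "norm (x a) ^ m \<le> decr_rearr x n ^ m"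
    by (intro power_mono) auto
  moreover have n: "card (A - {a}) = n"
    using Suc a by simp
  then have "(\<Sum>i\<in>A - {a}. norm (x i) ^ m) \<le> (\<Sum>k<n. decr_rearr x k ^ m)"
    using Suc.hyps(1)[of "A - {a}"] Suc.prems by simp
  ultimately show ?case
    using Suc a by (simp add: sum.remove[of A a] flip: Suc.hyps(2))
qed auto

lemma ex_max_norm_outside:
  fixes x :: "nat \<Rightarrow> 'a::real_normed_field"
  assumes "x \<longlonglongrightarrow> 0" "finite A"
  shows "\<exists>a. a \<notin> A \<and> (\<forall>i. i \<notin> A \<longrightarrow> norm (x i) \<le> norm (x a))"
proof (cases "\<exists>i. i \<notin> A \<and> x i \<noteq> 0")
  case True
  then obtain i0 where i0: "i0 \<notin> A" "x i0 \<noteq> 0" by blast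
  define B where "B = {i. norm (x i0) \<le> norm (x i)} - A"
  have "\<forall>\<^sub>F i in sequentially. norm (x i) < norm (x i0)"
    using assms(1) i0 by (intro order_tendstoD(2)[of _ 0]) (auto intro: tendsto_norm_zero)
  then obtain n where "\<And>i. n \<le> i \<Longrightarrow> norm (x i) < norm (x i0)"
    by (auto simp: eventually_sequentially)
  then have "B \<subseteq> {..<n}" by (force simp: B_def not_less[symmetric])
  then have "finite B" by (rule finite_subset) simp
  moreover have "B \<noteq> {}" using i0 by (auto simp: B_def)
  ultimately have "Max ((\<lambda>i. norm (x i)) ` B) \<in> (\<lambda>i. norm (x i)) ` B"
    by (intro Max_in) auto
  then obtain a where a: "a \<in> B" "norm (x a) = Max ((\<lambda>i. norm (x i)) ` B)"
    by auto
  have max: "norm (x i) \<le> norm (x a)" if "i \<in> B" for i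
    unfolding a(2) using that \<open>finite B\<close> by (intro Max_ge) auto
  show ?thesis
  proof (intro exI[of _ a] conjI allI impI)
    show "norm (x i) \<le> norm (x a)" if "i \<notin> A" for i
    proof (cases "i \<in> B")
      case False
      then have "norm (x i) < norm (x i0)" using that by (auto simp: B_def)
      moreover have "norm (x i0) \<le> norm (x a)" using a(1) by (simp add: B_def)
      ultimately show ?thesis by simp
    qed (rule max)
  qed (use a in \<open>auto simp: B_def\<close>)
next
  case False
  obtain a where "a \<notin> A" using assms(2) ex_new_if_finite infinite_UNIV_nat by blast
  with False show ?thesis by (intro exI[of _ a]) auto
qed

text \<open>Greedy choice: adjoin the largest remaining term. Only the n indices chosen before can
  exceed its modulus, so that modulus is a level for position n. Together with
  \<open>sum_norm_power_le_decr_rearr\<close> this lets sums over finite sets replace the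
  rearrangement.\<close>

lemma ex_sum_decr_rearr_le:
  fixes x :: "nat \<Rightarrow> 'a::real_normed_field"
  assumes "x \<longlonglongrightarrow> 0"
  shows "\<exists>A. finite A \<and> card A = n \<and> (\<Sum>k<n. decr_rearr x k) \<le> (\<Sum>i\<in>A. norm (x i))"
proof (induction n)
  case (Suc n)
  then obtain A where A: "finite A" "card A = n" "(\<Sum>k<n. decr_rearr x k) \<le> (\<Sum>i\<in>A. norm (x i))"
    by blast
  obtain a where a: "a \<notin> A" "\<And>i. i \<notin> A \<Longrightarrow> norm (x i) \<le> norm (x a)"
    using ex_max_norm_outside[OF assms A(1)] by blast
  have sub: "{i. norm (x a) < norm (x i)} \<subseteq> A"
    using a(2) leD by blast
  have "decr_rearr x n \<le> norm (x a)"
    unfolding decr_rearr_def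
  proof (rule cInf_lower[OF _ levels_bdd_below])
    show "norm (x a) \<in> levels x n"
      using finite_subset[OF sub A(1)] card_mono[OF A(1) sub] A(2) by simp
  qed
  then show ?case
    using A a(1) by (intro exI[of _ "insert a A"]) simp
qed (intro exI[of _ "{}"], simp)

lemma infinite_levels_if_not_tendsto_0:
  fixes x :: "nat \<Rightarrow> 'a::real_normed_vector"
  assumes "\<not> x \<longlonglongrightarrow> 0"
  shows "\<exists>c>0. infinite {i. c \<le> norm (x i)}"
proof -
  obtain c where c: "0 < c" "\<And>n. \<exists>i\<ge>n. c \<le> norm (x i)"
    using assms by (auto simp: LIMSEQ_iff not_less)
  have False if fin: "finite {i. c \<le> norm (x i)}"
  proof -
    obtain n where n: "\<And>i. c \<le> norm (x i) \<Longrightarrow> i < n"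
      using fin unfolding finite_nat_set_iff_bounded by blast
    obtain i where "n \<le> i" "c \<le> norm (x i)"
      using c(2) by blast
    with n[of i] show False by simp
  qed
  with c(1) show ?thesis by blast
qed

section \<open>Admissible weights and the predual in terms of finite sums\<close>

locale admissible_weight =
  fixes w :: "nat \<Rightarrow> real"
  assumes admissible: "admissible w"
begin

lemma decseq_w: "decseq w" and w_nonneg: "0 \<le> w i" and w_0: "w 0 = 1" and not_summable_w: "\<not> summable w"
  using admissible by (auto simp: admissible_def)

lemma w_pos: "0 < w i"
proof (rule ccontr)
  assume "\<not> 0 < w i"
  then have "w j = 0" if "i \<le> j" for j
    using decseqD[OF decseq_w that] w_nonneg[of j] by linarith
  then have "summable w"
    by (intro summable_finite[of "{..<i}"]) (auto simp: not_less)
  then show False using not_summable_w by simp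
qed

lemma w_le_1: "w i \<le> 1"
  using decseqD[OF decseq_w, of 0 i] w_0 by simp

lemma W_0 [simp]: "W w 0 = 0"
  by (simp add: W_def)

lemma W_Suc: "W w (Suc n) = W w n + w n"
  by (simp add: W_def)

lemma W_1: "W w (Suc 0) = 1"
  by (simp add: W_def w_0)

lemma W_mono: "m \<le> n \<Longrightarrow> W w m \<le> W w n"
  unfolding W_def by (rule sum_mono2) (auto simp: w_nonneg)

lemma W_nonneg: "0 \<le> W w n"
  unfolding W_def by (simp add: sum_nonneg w_nonneg)

lemma W_pos: "1 \<le> n \<Longrightarrow> 0 < W w n"
  using W_mono[of 1 n] W_1 by simp

lemma W_le: "W w n \<le> real n"
  using sum_mono[of "{..<n}" w "\<lambda>_. 1"] w_le_1 by (simp add: W_def)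

lemma W_at_top: "filterlim (W w) at_top sequentially"
proof -
  have "\<exists>n. Z < W w n" for Z
  proof (rule ccontr)
    assume "\<not> ?thesis"
    then have Z: "(\<Sum>i<n. w i) \<le> Z" for n
      by (simp add: not_less W_def)
    have "summable w"
      by (rule bounded_imp_summable[of w Z])
        (simp add: w_nonneg, simp only: Z flip: lessThan_Suc_atMost)
    then show False using not_summable_w by simp
  qed
  then have "\<exists>N. \<forall>n\<ge>N. Z \<le> W w n" for Z
    by (metis W_mono less_le_trans less_imp_le)
  then show ?thesis
    by (simp add: filterlim_at_top eventually_sequentially)
qed

text \<open>Since W n <= n, infinitely many terms of modulus at least c would give sums of at least
  c n, against c n / 2. The hypothesis is the finite-set condition, not membership, so that the
  lemma can serve in proving that the two agree.\<close>

lemma d_lower_tendsto_0_aux: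
  fixes x :: "nat \<Rightarrow> 'a::real_normed_field"
  assumes "\<And>e. 0 < e \<Longrightarrow> \<exists>m. \<forall>A. finite A \<longrightarrow> m \<le> card A \<longrightarrow> (\<Sum>i\<in>A. norm (x i)) \<le> e * W w (card A)"
  shows "x \<longlonglongrightarrow> 0"
proof (rule ccontr)
  assume "\<not> x \<longlonglongrightarrow> 0"
  then obtain c where c: "0 < c" and inf: "infinite {i. c \<le> norm (x i)}"
    using infinite_levels_if_not_tendsto_0 by blast
  obtain m where m: "\<And>A. finite A \<Longrightarrow> m \<le> card A \<Longrightarrow> (\<Sum>i\<in>A. norm (x i)) \<le> c / 2 * W w (card A)"
    using assms[of "c / 2"] c by auto
  obtain A where A: "finite A" "card A = Suc m" "A \<subseteq> {i. c \<le> norm (x i)}"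
    using infinite_arbitrarily_large[OF inf] by blast
  have "c * real (Suc m) = (\<Sum>i\<in>A. c)"
    using A by simp
  also have "\<dots> \<le> (\<Sum>i\<in>A. norm (x i))"
    using A by (intro sum_mono) auto
  also have "\<dots> \<le> c / 2 * W w (Suc m)"
    using m[of A] A by simp
  also have "\<dots> \<le> c / 2 * real (Suc m)"
    using c by (intro mult_left_mono W_le) auto
  finally show False using c by simp
qed

text \<open>Rearrangements do not respect addition, whereas sums over a fixed finite set obey the
  triangle inequality. In this form the vector space properties become immediate.\<close>

lemma d_lower_iff:
  fixes x :: "nat \<Rightarrow> 'a::real_normed_field"
  shows "x \<in> d_lower w \<longleftrightarrow>
    (\<forall>e>0. \<exists>m. \<forall>A. finite A \<longrightarrow> m \<le> card A \<longrightarrow> (\<Sum>i\<in>A. norm (x i)) \<le> e * W w (card A))"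
    (is "_ \<longleftrightarrow> ?R")
proof
  assume x: "x \<in> d_lower w"
  then have b: "Bseq x" and lim: "W_ratio w x \<longlonglongrightarrow> 0"
    by (auto simp: d_lower_def d_upper_def)
  show ?R
  proof (intro allI impI)
    fix e :: real assume e: "0 < e"
    then obtain m where m: "\<And>n. m \<le> n \<Longrightarrow> W_ratio w x n < e"
      using order_tendstoD(2)[OF lim] by (auto simp: eventually_sequentially)
    \<comment> \<open>\<open>Suc m\<close> keeps the cardinality positive, so that
      \<open>W w (card A)\<close> is positive and the quotient can be cleared.\<close>
    have "(\<Sum>i\<in>A. norm (x i)) \<le> e * W w (card A)" if A: "finite A" "Suc m \<le> card A" for A
    proof -
      have "(\<Sum>i\<in>A. norm (x i)) \<le> (\<Sum>k<card A. decr_rearr x k)"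
        using sum_norm_power_le_decr_rearr[OF b A(1), of 1] by simp
      also have "\<dots> \<le> e * W w (card A)"
        using m[of "card A"] A W_pos[of "card A"] by (simp add: W_ratio_def field_simps)
      finally show ?thesis .
    qed
    then show "\<exists>m. \<forall>A. finite A \<longrightarrow> m \<le> card A \<longrightarrow> (\<Sum>i\<in>A. norm (x i)) \<le> e * W w (card A)"
      by blast
  qed
next
  assume R: ?R
  then have x0: "x \<longlonglongrightarrow> 0"
    by (intro d_lower_tendsto_0_aux) blast
  then have b: "Bseq x"
    by (intro convergent_imp_Bseq convergentI)
  have lim: "W_ratio w x \<longlonglongrightarrow> 0"
  proof (rule LIMSEQ_I)
    fix e :: real assume e: "0 < e"
    then obtain m where m: "\<And>A. finite A \<Longrightarrow> m \<le> card A \<Longrightarrow> (\<Sum>i\<in>A. norm (x i)) \<le> e / 2 * W w (card A)"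
      using R[rule_format, of "e / 2"] by (metis half_gt_zero)
    have "norm (W_ratio w x n - 0) < e" if n: "Suc m \<le> n" for n
    proof -
      obtain A where A: "finite A" "card A = n" "(\<Sum>k<n. decr_rearr x k) \<le> (\<Sum>i\<in>A. norm (x i))"
        using ex_sum_decr_rearr_le[OF x0] by blast
      have "(\<Sum>k<n. decr_rearr x k) \<le> e / 2 * W w n"
        using m[of A] A n by simp
      then have "W_ratio w x n \<le> e / 2"
        using n W_pos[of n] by (simp add: W_ratio_def field_simps)
      moreover have "0 \<le> W_ratio w x n"
        unfolding W_ratio_def by (intro divide_nonneg_nonneg sum_nonneg decr_rearr_nonneg b W_nonneg)
      ultimately show ?thesis using e by simp
    qed
    then show "\<exists>no. \<forall>n\<ge>no. norm (W_ratio w x n - 0) < e" by blast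
  qed
  moreover have "bdd_above (W_ratio w x ` {1..})"
  proof -
    have "Bseq (W_ratio w x)"
      using lim by (intro convergent_imp_Bseq convergentI)
    then obtain K where "\<And>n. norm (W_ratio w x n) \<le> K"
      unfolding Bseq_def by blast
    then show ?thesis
      by (intro bdd_aboveI[of _ K]) (force simp: abs_le_iff)
  qed
  ultimately show "x \<in> d_lower w"
    using b by (simp add: d_lower_def d_upper_def)
qed

lemma d_lower_D:
  assumes "x \<in> d_lower w" "0 < e"
  shows "\<exists>m. \<forall>A. finite A \<longrightarrow> m \<le> card A \<longrightarrow> (\<Sum>i\<in>A. norm (x i)) \<le> e * W w (card A)"
  using assms(1)[unfolded d_lower_iff, rule_format, OF assms(2)] .

lemma d_lower_tendsto_0: "x \<in> d_lower w \<Longrightarrow> x \<longlonglongrightarrow> 0"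
  by (rule d_lower_tendsto_0_aux) (simp add: d_lower_iff)

lemma d_lower_Bseq: "x \<in> d_lower w \<Longrightarrow> Bseq x"
  by (simp add: d_lower_def d_upper_def)

lemma W_ratio_le_norm_W:
  assumes "x \<in> d_lower w" "1 \<le> n"
  shows "W_ratio w x n \<le> norm_W w x"
  unfolding norm_W_def using assms by (intro cSUP_upper) (simp_all add: d_lower_def d_upper_def)

lemma sum_decr_rearr_le_norm_W:
  assumes "x \<in> d_lower w"
  shows "(\<Sum>k<n. decr_rearr x k) \<le> norm_W w x * W w n"
proof (cases "n = 0")
  case False
  then show ?thesis
    using W_ratio_le_norm_W[OF assms, of n] W_pos[of n] by (simp add: W_ratio_def field_simps)
qed simp

text \<open>The same replacement of the rearrangement by arbitrary finite sets, now for the norm: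
  the upper bound for sums over A gives one direction, the greedy sets give the other.\<close>

lemma norm_W_le_iff:
  assumes "x \<in> d_lower w"
  shows "norm_W w x \<le> r \<longleftrightarrow> (\<forall>A. finite A \<longrightarrow> (\<Sum>i\<in>A. norm (x i)) \<le> r * W w (card A))"
proof (intro iffI allI impI)
  fix A :: "nat set" assume r: "norm_W w x \<le> r" and A: "finite A"
  have "(\<Sum>i\<in>A. norm (x i)) \<le> (\<Sum>k<card A. decr_rearr x k)"
    using sum_norm_power_le_decr_rearr[OF d_lower_Bseq[OF assms] A, of 1] by simp
  also have "\<dots> \<le> norm_W w x * W w (card A)"
    by (rule sum_decr_rearr_le_norm_W[OF assms])
  also have "\<dots> \<le> r * W w (card A)"
    by (intro mult_right_mono r W_nonneg)
  finally show "(\<Sum>i\<in>A. norm (x i)) \<le> r * W w (card A)" .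
next
  assume r: "\<forall>A. finite A \<longrightarrow> (\<Sum>i\<in>A. norm (x i)) \<le> r * W w (card A)"
  show "norm_W w x \<le> r"
    unfolding norm_W_def
  proof (rule cSUP_least)
    fix n :: nat assume n: "n \<in> {1..}"
    obtain A where A: "finite A" "card A = n" "(\<Sum>k<n. decr_rearr x k) \<le> (\<Sum>i\<in>A. norm (x i))"
      using ex_sum_decr_rearr_le[OF d_lower_tendsto_0[OF assms]] by blast
    then have "(\<Sum>k<n. decr_rearr x k) \<le> r * W w n"
      using r by force
    then show "W_ratio w x n \<le> r"
      using n W_pos[of n] by (simp add: W_ratio_def field_simps)
  qed simp
qed

lemma norm_le_norm_W:
  assumes "x \<in> d_lower w"
  shows "norm (x i) \<le> norm_W w x"
proof -
  have "(\<Sum>j\<in>{i}. norm (x j)) \<le> norm_W w x * W w (card {i})"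
    by (rule norm_W_le_iff[OF assms, THEN iffD1, OF order_refl, rule_format]) simp
  then show ?thesis by (simp add: W_1)
qed

lemma norm_W_nonneg: "x \<in> d_lower w \<Longrightarrow> 0 \<le> norm_W w x"
  by (rule order_trans[OF norm_ge_zero norm_le_norm_W])

lemma d_lower_add:
  assumes "x \<in> d_lower w" "y \<in> d_lower w"
  shows "(\<lambda>i. x i + y i) \<in> d_lower w"
  unfolding d_lower_iff
proof (intro allI impI)
  fix e :: real assume "0 < e"
  then have e: "0 < e / 2" by simp
  obtain m where m: "\<And>A. finite A \<Longrightarrow> m \<le> card A \<Longrightarrow> (\<Sum>i\<in>A. norm (x i)) \<le> e / 2 * W w (card A)"
    using d_lower_D[OF assms(1) e] by blast
  obtain n where n: "\<And>A. finite A \<Longrightarrow> n \<le> card A \<Longrightarrow> (\<Sum>i\<in>A. norm (y i)) \<le> e / 2 * W w (card A)"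
    using d_lower_D[OF assms(2) e] by blast
  have "(\<Sum>i\<in>A. norm (x i + y i)) \<le> e * W w (card A)" if "finite A" "max m n \<le> card A" for A
  proof -
    have "(\<Sum>i\<in>A. norm (x i + y i)) \<le> (\<Sum>i\<in>A. norm (x i)) + (\<Sum>i\<in>A. norm (y i))"
      unfolding sum.distrib[symmetric] by (intro sum_mono norm_triangle_ineq)
    also have "\<dots> \<le> e / 2 * W w (card A) + e / 2 * W w (card A)"
      using that by (intro add_mono m n) auto
    finally show ?thesis by simp
  qed
  then show "\<exists>m. \<forall>A. finite A \<longrightarrow> m \<le> card A \<longrightarrow> (\<Sum>i\<in>A. norm (x i + y i)) \<le> e * W w (card A)"
    by blast
qed

lemma d_lower_mult:
  assumes "x \<in> d_lower w"
  shows "(\<lambda>i. c * x i) \<in> d_lower w"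
  unfolding d_lower_iff
proof (intro allI impI)
  fix e :: real assume e: "0 < e"
  have c: "0 < norm c + 1"
    by (simp add: add_nonneg_pos)
  obtain m where m: "\<And>A. finite A \<Longrightarrow> m \<le> card A \<Longrightarrow> (\<Sum>i\<in>A. norm (x i)) \<le> e / (norm c + 1) * W w (card A)"
    using d_lower_D[OF assms divide_pos_pos[OF e c]] by blast
  have "(\<Sum>i\<in>A. norm (c * x i)) \<le> e * W w (card A)" if "finite A" "m \<le> card A" for A
  proof -
    have "(\<Sum>i\<in>A. norm (c * x i)) \<le> (norm c + 1) * (\<Sum>i\<in>A. norm (x i))"
      unfolding sum_distrib_left by (intro sum_mono) (simp add: norm_mult mult_right_mono)
    also have "\<dots> \<le> (norm c + 1) * (e / (norm c + 1) * W w (card A))"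
      using that c by (intro mult_left_mono m) auto
    also have "\<dots> = e * W w (card A)"
      using c by simp
    finally show ?thesis .
  qed
  then show "\<exists>m. \<forall>A. finite A \<longrightarrow> m \<le> card A \<longrightarrow> (\<Sum>i\<in>A. norm (c * x i)) \<le> e * W w (card A)"
    by blast
qed

lemma d_lower_diff:
  assumes "x \<in> d_lower w" "y \<in> d_lower w"
  shows "(\<lambda>i. x i - y i) \<in> d_lower w"
  using d_lower_add[OF assms(1) d_lower_mult[OF assms(2), of "-1"]] by simp

lemma d_lower_0: "(\<lambda>_. 0) \<in> d_lower w"
  by (simp add: d_lower_iff W_nonneg)

text \<open>All sums are bounded by one number S, while W is unbounded because the weights are not
  summable.\<close>

lemma d_lower_finite_support:
  fixes x :: "nat \<Rightarrow> 'a::real_normed_field"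
  assumes "finite {i. x i \<noteq> 0}"
  shows "x \<in> d_lower w"
  unfolding d_lower_iff
proof (intro allI impI)
  fix e :: real assume e: "0 < e"
  define S where "S = (\<Sum>i\<in>{i. x i \<noteq> 0}. norm (x i))"
  obtain m where m: "\<And>n. m \<le> n \<Longrightarrow> S / e \<le> W w n"
    using W_at_top by (auto simp: filterlim_at_top eventually_sequentially)
  have "(\<Sum>i\<in>A. norm (x i)) \<le> e * W w (card A)" if A: "finite A" "m \<le> card A" for A
  proof -
    have "(\<Sum>i\<in>A. norm (x i)) = (\<Sum>i\<in>A \<inter> {i. x i \<noteq> 0}. norm (x i))"
      by (intro sum.mono_neutral_right) (use A in auto)
    also have "\<dots> \<le> S"
      unfolding S_def by (intro sum_mono2) (use assms in auto)
    also have "\<dots> \<le> e * W w (card A)"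
      using m[OF A(2)] e by (simp add: field_simps)
    finally show ?thesis .
  qed
  then show "\<exists>m. \<forall>A. finite A \<longrightarrow> m \<le> card A \<longrightarrow> (\<Sum>i\<in>A. norm (x i)) \<le> e * W w (card A)"
    by blast
qed

lemma unit_ball_iff:
  "x \<in> unit_ball (d_lower w) (norm_W w) \<longleftrightarrow>
    x \<in> d_lower w \<and> (\<forall>A. finite A \<longrightarrow> (\<Sum>i\<in>A. norm (x i)) \<le> W w (card A))"
  by (cases "x \<in> d_lower w") (simp_all add: unit_ball_def norm_W_le_iff)

lemma norm_W_mult_le:
  assumes "x \<in> d_lower w" "norm_W w x \<le> r"
  shows "norm_W w (\<lambda>i. c * x i) \<le> norm c * r"
  unfolding norm_W_le_iff[OF d_lower_mult[OF assms(1)]]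
proof (intro allI impI)
  fix A :: "nat set" assume "finite A"
  then have "(\<Sum>i\<in>A. norm (x i)) \<le> r * W w (card A)"
    using assms by (simp add: norm_W_le_iff)
  then have "norm c * (\<Sum>i\<in>A. norm (x i)) \<le> norm c * (r * W w (card A))"
    by (rule mult_left_mono) simp
  then show "(\<Sum>i\<in>A. norm (c * x i)) \<le> norm c * r * W w (card A)"
    by (simp add: norm_mult sum_distrib_left mult_ac)
qed

lemma norm_W_add_le:
  assumes "x \<in> d_lower w" "norm_W w x \<le> r" "y \<in> d_lower w" "norm_W w y \<le> s"
  shows "norm_W w (\<lambda>i. x i + y i) \<le> r + s"
  unfolding norm_W_le_iff[OF d_lower_add[OF assms(1,3)]]
proof (intro allI impI)
  fix A :: "nat set" assume "finite A"
  then have "(\<Sum>i\<in>A. norm (x i)) \<le> r * W w (card A)" "(\<Sum>i\<in>A. norm (y i)) \<le> s * W w (card A)"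
    using assms by (simp_all add: norm_W_le_iff)
  moreover have "(\<Sum>i\<in>A. norm (x i + y i)) \<le> (\<Sum>i\<in>A. norm (x i)) + (\<Sum>i\<in>A. norm (y i))"
    unfolding sum.distrib[symmetric] by (intro sum_mono norm_triangle_ineq)
  ultimately show "(\<Sum>i\<in>A. norm (x i + y i)) \<le> (r + s) * W w (card A)"
    by (simp add: algebra_simps)
qed

text \<open>No point of the unit ball is extreme: the tail of \<open>a\<close> leaves room for small perturbations.\<close>
lemma unit_ball_perturbation:
  fixes a :: "nat \<Rightarrow> 'a::real_normed_field"
  assumes a: "a \<in> unit_ball (d_lower w) (norm_W w)"
  obtains n0 \<delta> where "0 < \<delta>" "\<delta> \<le> 1"
    "\<And>n c. \<lbrakk>n0 \<le> n; norm c \<le> \<delta>\<rbrakk> \<Longrightarrow>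
      (\<lambda>i. a i + c * (if i = n then 1 else 0)) \<in> unit_ball (d_lower w) (norm_W w)"
proof -
  have ad: "a \<in> d_lower w" and aA: "\<And>A. finite A \<Longrightarrow> (\<Sum>i\<in>A. norm (a i)) \<le> W w (card A)"
    using a by (auto simp: unit_ball_iff)
  obtain m where m: "\<And>A. finite A \<Longrightarrow> m \<le> card A \<Longrightarrow> (\<Sum>i\<in>A. norm (a i)) \<le> 1 / 2 * W w (card A)"
    using d_lower_D[OF ad, of "1/2"] half_gt_zero[OF zero_less_one] by blast
  \<comment> \<open>Beyond the index m of slack, sums of |a i| use at most half of W. For smaller
    sets the room is the single weight \<open>w m\<close>, and \<open>2 * \<delta>\<close> fits into
    it.\<close>
  define \<delta> where "\<delta> = w m / (2 * (real m + 1))"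
  have \<delta>0: "0 < \<delta>"
    using w_pos[of m] by (simp add: \<delta>_def)
  have "\<delta> \<le> w m / 2"
    using w_pos[of m] by (simp add: \<delta>_def field_simps)
  then have \<delta>: "\<delta> \<le> 1 / 2"
    using w_le_1[of m] by linarith
  have \<delta>m: "(real m + 1) * (2 * \<delta>) = w m"
    unfolding \<delta>_def by (simp add: field_simps add_nonneg_eq_0_iff)
  obtain n0 where n0: "\<And>n. n0 \<le> n \<Longrightarrow> norm (a n) < \<delta>"
    using d_lower_tendsto_0[OF ad] \<delta>0 by (auto simp: LIMSEQ_iff)
  have "(\<lambda>i. a i + c * (if i = n then 1 else 0)) \<in> unit_ball (d_lower w) (norm_W w)"
    if n: "n0 \<le> n" and c: "norm c \<le> \<delta>" for n and c :: 'a
    unfolding unit_ball_iff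
  proof (intro conjI allI impI)
    show "(\<lambda>i. a i + c * (if i = n then 1 else 0)) \<in> d_lower w"
      by (intro d_lower_add ad d_lower_mult d_lower_finite_support) auto
    fix A :: "nat set" assume A: "finite A"
    show "(\<Sum>i\<in>A. norm (a i + c * (if i = n then 1 else 0))) \<le> W w (card A)"
    proof (cases "n \<in> A")
      case False
      then have "(\<Sum>i\<in>A. norm (a i + c * (if i = n then 1 else 0))) = (\<Sum>i\<in>A. norm (a i))"
        by (intro sum.cong) auto
      then show ?thesis using aA[OF A] by simp
    next
      case True
      have "(\<Sum>i\<in>A. norm (a i + c * (if i = n then 1 else 0)))
          = norm (a n + c) + (\<Sum>i\<in>A - {n}. norm (a i))"
        using A True by (simp add: sum.remove[of A n])
      also have "\<dots> \<le> \<delta> + norm (a n) + (\<Sum>i\<in>A - {n}. norm (a i))"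
        using norm_triangle_ineq[of "a n" c] c by linarith
      finally have le: "(\<Sum>i\<in>A. norm (a i + c * (if i = n then 1 else 0)))
          \<le> \<delta> + norm (a n) + (\<Sum>i\<in>A - {n}. norm (a i))" .
      have card: "card A = Suc (card (A - {n}))"
        by (rule card.remove[OF A True])
      show ?thesis
      proof (cases "m \<le> card A")
        case False
        \<comment> \<open>Small sets: the perturbed entry at n has modulus at most
          \<open>2 * \<delta>\<close>, no more than the weight by which W grows from A - {n} to
          A.\<close>
        have "0 \<le> real m * \<delta>"
          using \<delta>0 by simp
        then have "\<delta> + norm (a n) \<le> (real m + 1) * (2 * \<delta>)"
          using n0[OF n] \<delta>0 unfolding distrib_right by linarith
        also have "\<dots> \<le> w (card (A - {n}))"
          unfolding \<delta>m using False card by (intro decseqD[OF decseq_w]) auto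
        finally show ?thesis
          using le aA[of "A - {n}"] A card by (simp add: W_Suc)
      next
        case mA: True
        have "norm (a n) + (\<Sum>i\<in>A - {n}. norm (a i)) = (\<Sum>i\<in>A. norm (a i))"
          using A True by (simp add: sum.remove[of A n])
        also have "\<dots> \<le> 1 / 2 * W w (card A)"
          by (rule m[OF A mA])
        finally show ?thesis
          using le \<delta> W_mono[of 1 "card A"] W_1 card by simp
      qed
    qed
  qed
  with that[of \<delta> n0] \<delta>0 \<delta> show ?thesis by simp
qed

text \<open>The partial sums of the decreasing rearrangement of x are at most those of r w by
  definition of the norm, and majorization passes to M-th powers.\<close>

lemma d_lower_lp_space:
  fixes x :: "nat \<Rightarrow> 'a::real_normed_field"
  assumes M: "w \<in> lp_space M" and x: "x \<in> d_lower w" and r: "norm_W w x \<le> r"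
  shows "x \<in> lp_space M" and "lp_sum M x \<le> r ^ M * lp_sum M w"
proof -
  have r0: "0 \<le> r"
    using norm_W_nonneg[OF x] r by simp
  have s: "summable (\<lambda>i. w i ^ M)"
    using M w_nonneg by (simp add: lp_space_def)
  have "(\<Sum>i<n. norm (x i) ^ M) \<le> r ^ M * lp_sum M w" for n
  proof -
    have "(\<Sum>i<n. norm (x i) ^ M) \<le> (\<Sum>k<n. decr_rearr x k ^ M)"
      using sum_norm_power_le_decr_rearr[OF d_lower_Bseq[OF x], of "{..<n}" M] by simp
    also have "\<dots> \<le> (\<Sum>k<n. (r * w k) ^ M)"
    proof (rule sum_power_le_of_majorized)
      fix n
      have "(\<Sum>k<n. decr_rearr x k) \<le> norm_W w x * W w n"
        by (rule sum_decr_rearr_le_norm_W[OF x])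
      also have "\<dots> \<le> r * W w n"
        by (intro mult_right_mono r W_nonneg)
      finally show "(\<Sum>k<n. decr_rearr x k) \<le> (\<Sum>k<n. r * w k)"
        by (simp add: W_def sum_distrib_left)
    qed (use d_lower_Bseq[OF x] r0 w_nonneg in \<open>auto intro: decr_rearr_nonneg decseq_decr_rearr\<close>)
    also have "\<dots> = r ^ M * (\<Sum>k<n. w k ^ M)"
      by (simp add: power_mult_distrib sum_distrib_left)
    also have "\<dots> \<le> r ^ M * lp_sum M w"
      using r0 w_nonneg s by (intro mult_left_mono) (auto simp: lp_sum_def intro!: sum_le_suminf)
    finally show ?thesis .
  qed
  note le = this
  have sx: "summable (\<lambda>i. norm (x i) ^ M)"
    by (rule bounded_imp_summable[of _ "r ^ M * lp_sum M w"])
      (simp, simp only: le flip: lessThan_Suc_atMost)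
  then show "x \<in> lp_space M" by (simp add: lp_space_def)
  show "lp_sum M x \<le> r ^ M * lp_sum M w"
    unfolding lp_sum_def[of M x] by (rule suminf_le_const[OF sx le])
qed

end

section \<open>Real multilinear maps\<close>

text \<open>Multilinearity over the reals, on total tuples of which only the first N entries count.
  The target is arbitrary, so the same expansion serves the coordinates of a vector-valued map and
  its compositions with the real-linear \<open>lp_tangent\<close>, over either scalar field.\<close>

locale real_multilinear =
  fixes N :: nat and X :: "(nat \<Rightarrow> 'a::real_normed_field) set"
    and G :: "(nat \<Rightarrow> nat \<Rightarrow> 'a) \<Rightarrow> 'v::real_normed_vector"
  assumes zero_mem: "(\<lambda>_. 0) \<in> X"
    and add_mem: "\<And>x y. x \<in> X \<Longrightarrow> y \<in> X \<Longrightarrow> (\<lambda>i. x i + y i) \<in> X"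
    and scale_mem: "\<And>x c. x \<in> X \<Longrightarrow> (\<lambda>i. of_real c * x i) \<in> X"
    and cong_below: "\<And>b b'. (\<And>j. j < N \<Longrightarrow> b j = b' j) \<Longrightarrow> G b = G b'"
    and add: "\<And>b j x y. \<lbrakk>\<And>k. k < N \<Longrightarrow> b k \<in> X; j < N; x \<in> X; y \<in> X\<rbrakk> \<Longrightarrow>
      G (b(j := (\<lambda>i. x i + y i))) = G (b(j := x)) + G (b(j := y))"
    and scale: "\<And>b j x c. \<lbrakk>\<And>k. k < N \<Longrightarrow> b k \<in> X; j < N; x \<in> X\<rbrakk> \<Longrightarrow>
      G (b(j := (\<lambda>i. of_real c * x i))) = c *\<^sub>R G (b(j := x))"
begin

lemma homogeneous_on:
  assumes "\<And>k. k < N \<Longrightarrow> b k \<in> X" "finite T" "T \<subseteq> {..<N}"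
  shows "G (\<lambda>j. if j \<in> T then (\<lambda>i. of_real c * b j i) else b j) = c ^ card T *\<^sub>R G b"
  using assms(2,3)
proof induction
  case (insert p T)
  define b' where "b' = (\<lambda>j. if j \<in> T then (\<lambda>i. of_real c * b j i) else b j)"
  have b': "b' k \<in> X" if "k < N" for k
    using assms(1)[OF that] by (simp add: b'_def scale_mem)
  have "(\<lambda>j. if j \<in> insert p T then (\<lambda>i. of_real c * b j i) else b j)
      = b'(p := (\<lambda>i. of_real c * b p i))"
    by (auto simp: b'_def)
  moreover have "b'(p := b p) = b'"
    using insert by (auto simp: b'_def)
  ultimately show ?case
    using scale[where b=b' and j=p and x="b p" and c=c, OF b'] insert assms by (simp add: b'_def)
qed simp

lemma homogeneous:
  assumes "\<And>k. k < N \<Longrightarrow> b k \<in> X"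
  shows "G (\<lambda>j i. of_real c * b j i) = c ^ N *\<^sub>R G b"
  using homogeneous_on[OF assms, where T = "{..<N}" and c = c]
    cong_below[of "\<lambda>j i. of_real c * b j i" "\<lambda>j. if j < N then (\<lambda>i. of_real c * b j i) else b j"]
  by simp

lemma sum_mem:
  assumes "finite J" "\<And>l. l \<in> J \<Longrightarrow> f l \<in> X"
  shows "(\<lambda>i. \<Sum>l\<in>J. of_real (s l) * f l i) \<in> X"
  using assms
proof induction
  case (insert l J)
  then show ?case
    using add_mem[OF scale_mem[where x="f l" and c="s l"], where y="\<lambda>i. \<Sum>l\<in>J. of_real (s l) * f l i"] by simp
qed (simp add: zero_mem)

lemma linear_sum:
  assumes b: "\<And>k. k < N \<Longrightarrow> b k \<in> X" and p: "p < N"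
    and J: "finite J" and f: "\<And>l. l \<in> J \<Longrightarrow> f l \<in> X"
  shows "G (b(p := (\<lambda>i. \<Sum>l\<in>J. of_real (s l) * f l i))) = (\<Sum>l\<in>J. s l *\<^sub>R G (b(p := f l)))"
  using J f
proof induction
  case empty
  show ?case
    using scale[where b=b and c=0, OF b p zero_mem] by (simp del: fun_upd_apply)
next
  case (insert l J)
  then show ?case
    using add[where b=b, OF b p scale_mem[where x="f l" and c="s l"] sum_mem[of J f s]]
      scale[where b=b, OF b p, where x="f l" and c="s l"]
    by (simp del: fun_upd_apply)
qed

text \<open>A binomial formula for a map that may fail to be symmetric: the coefficient of order k
  sums over the sets S of k slots that receive v.\<close>

lemma expansion:
  assumes a: "a \<in> X" and v: "v \<in> X"
  shows "G (\<lambda>j i. a i + of_real t * v i)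
    = (\<Sum>k\<le>N. t ^ k *\<^sub>R (\<Sum>S | S \<subseteq> {..<N} \<and> card S = k. G (\<lambda>j. if j \<in> S then v else a)))"
proof -
  define z where "z = (\<lambda>i. a i + of_real t * v i)"
  have z: "z \<in> X"
    unfolding z_def by (intro add_mem scale_mem a v)
  \<comment> \<open>Only the slots in T are expanded and the background b is arbitrary. The
    induction puts a or v into slot p of the background before using the hypothesis for the other
    slots.\<close>
  have "G (\<lambda>j. if j \<in> T then z else b j)
      = (\<Sum>S\<in>Pow T. t ^ card S *\<^sub>R G (\<lambda>j. if j \<in> S then v else if j \<in> T then a else b j))"
    if "finite T" "T \<subseteq> {..<N}" "\<And>k. k < N \<Longrightarrow> b k \<in> X" for T b
    using that
  proof (induction arbitrary: b)
    case (insert p T)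
    define b' where "b' = (\<lambda>j. if j \<in> T then z else b j)"
    have b': "b' k \<in> X" if "k < N" for k
      using insert.prems(2)[OF that] z by (simp add: b'_def)
    have p: "p < N" using insert by simp
    have upd: "b'(p := y) = (\<lambda>j. if j \<in> T then z else (b(p := y)) j)" for y
      using insert by (auto simp: b'_def)
    have IH: "G (b'(p := y)) = (\<Sum>S\<in>Pow T. t ^ card S *\<^sub>R
        G (\<lambda>j. if j \<in> S then v else if j \<in> T then a else (b(p := y)) j))" if "y \<in> X" for y
      unfolding upd by (rule insert.IH) (use insert.prems that in auto)
    have eq_a: "(\<lambda>j. if j \<in> S then v else if j \<in> T then a else (b(p := a)) j)
        = (\<lambda>j. if j \<in> S then v else if j \<in> insert p T then a else b j)" for S
      by auto
    have eq_v: "(\<lambda>j. if j \<in> S then v else if j \<in> T then a else (b(p := v)) j)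
        = (\<lambda>j. if j \<in> insert p S then v else if j \<in> insert p T then a else b j)"
      if "S \<in> Pow T" for S
      using that insert.hyps by auto
    have "G (\<lambda>j. if j \<in> insert p T then z else b j) = G (b'(p := z))"
      by (rule arg_cong[of _ _ G]) (auto simp: b'_def)
    also have "\<dots> = G (b'(p := a)) + t *\<^sub>R G (b'(p := v))"
      unfolding z_def using add[OF b' p a scale_mem[OF v, where c=t]] scale[OF b' p v, where c=t] by simp
    also have "G (b'(p := a)) = (\<Sum>S\<in>Pow T. t ^ card S *\<^sub>R
        G (\<lambda>j. if j \<in> S then v else if j \<in> insert p T then a else b j))"
      unfolding IH[OF a] eq_a ..
    also have "t *\<^sub>R G (b'(p := v)) = (\<Sum>S\<in>Pow T. t ^ card (insert p S) *\<^sub>R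
        G (\<lambda>j. if j \<in> insert p S then v else if j \<in> insert p T then a else b j))"
      unfolding IH[OF v] scaleR_right.sum
    proof (rule sum.cong[OF refl])
      fix S assume S: "S \<in> Pow T"
      then have "p \<notin> S" "finite S"
        using insert.hyps by (auto intro: finite_subset)
      then show "t *\<^sub>R t ^ card S *\<^sub>R G (\<lambda>j. if j \<in> S then v else if j \<in> T then a else (b(p := v)) j)
          = t ^ card (insert p S) *\<^sub>R
            G (\<lambda>j. if j \<in> insert p S then v else if j \<in> insert p T then a else b j)"
        unfolding eq_v[OF S] by simp
    qed
    also have "\<dots> = (\<Sum>S\<in>insert p ` Pow T. t ^ card S *\<^sub>R
        G (\<lambda>j. if j \<in> S then v else if j \<in> insert p T then a else b j))"
    proof (subst sum.reindex)
      show "inj_on (insert p) (Pow T)"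
        using insert.hyps by (intro inj_onI) (auto simp: insert_ident)
    qed simp
    finally show ?case
      unfolding Pow_insert using insert.hyps
      by (subst sum.union_disjoint) auto
  qed simp
  from this[of "{..<N}" "\<lambda>_. a"]
  have "G (\<lambda>j. if j \<in> {..<N} then z else a)
      = (\<Sum>S\<in>Pow {..<N}. t ^ card S *\<^sub>R G (\<lambda>j. if j \<in> S then v else a))"
    using a by (simp cong: if_cong)
  \<comment> \<open>Subsets of slots are grouped by cardinality, which is the exponent of t.\<close>
  also have "\<dots> = (\<Sum>k\<le>N. \<Sum>S | S \<in> Pow {..<N} \<and> card S = k.
      t ^ card S *\<^sub>R G (\<lambda>j. if j \<in> S then v else a))"
  proof (rule sum.group[symmetric])
    show "card ` Pow {..<N} \<subseteq> {..N}"
      using card_mono[of "{..<N}"] by auto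
  qed auto
  also have "\<dots> = (\<Sum>k\<le>N. t ^ k *\<^sub>R (\<Sum>S | S \<subseteq> {..<N} \<and> card S = k. G (\<lambda>j. if j \<in> S then v else a)))"
    unfolding scaleR_right.sum by (intro sum.cong) auto
  finally show ?thesis
    using cong_below[of "\<lambda>j. z" "\<lambda>j. if j \<in> {..<N} then z else a"] by (simp add: z_def)
qed

end

text \<open>Unconditional summability of the \<open>f j\<close> passes to the diagonal of a bounded multilinear form,
  one argument at a time.\<close>
lemma sum_diagonal_le:
  fixes G :: "(nat \<Rightarrow> nat \<Rightarrow> 'a::real_normed_field) \<Rightarrow> real"
  assumes G: "real_multilinear N X G"
    and B: "B \<subseteq> X" and C: "\<And>b. (\<And>k. k < N \<Longrightarrow> b k \<in> B) \<Longrightarrow> \<bar>G b\<bar> \<le> C"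
    and J: "finite J" and f: "\<And>j. j \<in> J \<Longrightarrow> f j \<in> X"
    and signs: "\<And>s. (\<And>l. \<bar>s l\<bar> = 1) \<Longrightarrow> (\<lambda>i. \<Sum>l\<in>J. of_real (s l) * f l i) \<in> B"
    and S: "finite S" "S \<noteq> {}" "S \<subseteq> {..<N}" and b: "\<And>k. k < N \<Longrightarrow> b k \<in> B"
  shows "(\<Sum>j\<in>J. \<bar>G (\<lambda>k. if k \<in> S then f j else b k)\<bar>) \<le> C"
proof -
  interpret real_multilinear N X G by (rule G)
  show ?thesis
    using S b
  proof (induction arbitrary: b rule: finite_ne_induct)
    case (singleton p)
    have bX: "b k \<in> X" if "k < N" for k
      using singleton(2) that B by blast
    \<comment> \<open>With one slot the signs make every term nonnegative, and linearity turns the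
      sum into a single value of G at a point of B.\<close>
    define s where "s j = (if 0 \<le> G (b(p := f j)) then 1 else -1 :: real)" for j
    have s1: "\<bar>s l\<bar> = 1" for l
      by (simp add: s_def)
    have upd: "(\<lambda>k. if k \<in> {p} then y else b k) = b(p := y)" for y
      by auto
    have "(\<Sum>j\<in>J. \<bar>G (\<lambda>k. if k \<in> {p} then f j else b k)\<bar>) = (\<Sum>j\<in>J. s j * G (b(p := f j)))"
      unfolding upd by (intro sum.cong) (auto simp: s_def)
    also have "\<dots> = G (b(p := (\<lambda>i. \<Sum>l\<in>J. of_real (s l) * f l i)))"
      using singleton(1) by (subst linear_sum[OF bX _ J f]) auto
    also have "\<dots> \<le> C"
    proof (rule order_trans[OF abs_ge_self C])
      show "(b(p := (\<lambda>i. \<Sum>l\<in>J. of_real (s l) * f l i))) k \<in> B" if "k < N" for k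
        using singleton(2)[OF that] signs[OF s1] by simp
    qed
    finally show ?case .
  next
    case (insert p S)
    have bX: "b k \<in> X" if "k < N" for k
      using insert.prems(2) that B by blast
    \<comment> \<open>The slots in S carry f j and slot p carries f l, so the diagonal entries are
      the terms to be summed. The sign lemma merges the entries of slot p into one signed sum y in
      B, leaving a diagonal over S with y in the background.\<close>
    define A where "A j l = G (\<lambda>k. if k \<in> S then f j else (b(p := f l)) k)" for j l
    obtain s where s1: "\<And>l. \<bar>s l\<bar> = 1"
      and s: "(\<Sum>j\<in>J. \<bar>A j j\<bar>) \<le> (\<Sum>j\<in>J. \<bar>\<Sum>l\<in>J. s l * A j l\<bar>)"
      using signs_dominating_diagonal[OF J, of A] by blast
    define y where "y = (\<lambda>i. \<Sum>l\<in>J. of_real (s l) * f l i)"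
    have "(\<Sum>j\<in>J. \<bar>G (\<lambda>k. if k \<in> insert p S then f j else b k)\<bar>) = (\<Sum>j\<in>J. \<bar>A j j\<bar>)"
      unfolding A_def using insert.hyps
      by (intro sum.cong refl arg_cong[of _ _ "\<lambda>b. \<bar>G b\<bar>"]) auto
    also note s
    also have "(\<Sum>j\<in>J. \<bar>\<Sum>l\<in>J. s l * A j l\<bar>)
        = (\<Sum>j\<in>J. \<bar>G (\<lambda>k. if k \<in> S then f j else (b(p := y)) k)\<bar>)"
    proof (rule sum.cong[OF refl])
      fix j assume j: "j \<in> J"
      define b' where "b' = (\<lambda>k. if k \<in> S then f j else b k)"
      have b': "b' k \<in> X" if "k < N" for k
        using bX[OF that] f[OF j] by (simp add: b'_def)
      have upd: "(\<lambda>k. if k \<in> S then f j else (b(p := x)) k) = b'(p := x)" for x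
        using insert.hyps by (auto simp: b'_def)
      have "G (b'(p := y)) = (\<Sum>l\<in>J. s l *\<^sub>R G (b'(p := f l)))"
        unfolding y_def using insert.prems by (intro linear_sum[OF b' _ J f]) auto
      then show "\<bar>\<Sum>l\<in>J. s l * A j l\<bar> = \<bar>G (\<lambda>k. if k \<in> S then f j else (b(p := y)) k)\<bar>"
        by (simp add: A_def upd)
    qed
    also have "\<dots> \<le> C"
    proof (rule insert.IH)
      show "(b(p := y)) k \<in> B" if "k < N" for k
        using insert.prems(2)[OF that] signs[OF s1] by (simp add: y_def)
    qed (use insert.prems in auto)
    finally show ?case .
  qed
qed

section \<open>Multilinear maps on the predual\<close>

abbreviation unit_seq :: "nat \<Rightarrow> nat \<Rightarrow> 'a::zero_neq_one" where
  "unit_seq n \<equiv> (\<lambda>i. if i = n then 1 else 0)"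

context admissible_weight
begin

lemma real_multilinear_coordinate:
  fixes \<Phi> :: "(nat \<Rightarrow> nat \<Rightarrow> 'a::real_normed_field) \<Rightarrow> nat \<Rightarrow> 'a"
  assumes \<Phi>: "multilinear_on N (d_lower w) Y \<Phi>"
  shows "real_multilinear N (d_lower w) (\<lambda>b. \<Phi> (restrict b {..<N}) i)"
proof
  fix b :: "nat \<Rightarrow> nat \<Rightarrow> 'a" and j and x y :: "nat \<Rightarrow> 'a" and c :: real
  assume b: "\<And>k. k < N \<Longrightarrow> b k \<in> d_lower w" and j: "j < N" and x: "x \<in> d_lower w"
  have upd: "restrict (b(j := z)) {..<N} = (restrict b {..<N})(j := z)" for z
    using j by (auto simp: restrict_def)
  have b': "restrict b {..<N} \<in> {..<N} \<rightarrow>\<^sub>E d_lower w"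
    using b by auto
  show "\<Phi> (restrict (b(j := (\<lambda>i. of_real c * x i))) {..<N}) i = c *\<^sub>R \<Phi> (restrict (b(j := x)) {..<N}) i"
    using \<Phi> b' j x unfolding multilinear_on_def upd by (simp add: scaleR_conv_of_real)
  show "\<Phi> (restrict (b(j := (\<lambda>i. x i + y i))) {..<N}) i
      = \<Phi> (restrict (b(j := x)) {..<N}) i + \<Phi> (restrict (b(j := y)) {..<N}) i"
    if "y \<in> d_lower w"
    using \<Phi> b' j x that unfolding multilinear_on_def upd by simp
next
  fix b b' :: "nat \<Rightarrow> nat \<Rightarrow> 'a"
  assume "\<And>j. j < N \<Longrightarrow> b j = b' j"
  then have "restrict b {..<N} = restrict b' {..<N}"
    by (auto simp: restrict_def)
  then show "\<Phi> (restrict b {..<N}) i = \<Phi> (restrict b' {..<N}) i" by simp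
qed (auto intro: d_lower_0 d_lower_add d_lower_mult)

lemma multilinear_on_mem:
  assumes "multilinear_on N (d_lower w) Y \<Phi>" "\<And>k. k < N \<Longrightarrow> b k \<in> d_lower w"
  shows "\<Phi> (restrict b {..<N}) \<in> Y"
proof -
  have "restrict b {..<N} \<in> {..<N} \<rightarrow>\<^sub>E d_lower w"
    using assms(2) by auto
  then show ?thesis
    using assms(1) unfolding multilinear_on_def by blast
qed

lemma real_multilinear_lp_tangent:
  fixes \<Phi> :: "(nat \<Rightarrow> nat \<Rightarrow> 'a::{real_normed_field, real_inner}) \<Rightarrow> nat \<Rightarrow> 'a"
  assumes \<Phi>: "multilinear_on N (d_lower w) (lp_space M) \<Phi>" and M: "2 \<le> M" and u: "u \<in> lp_space M"
  shows "real_multilinear N (d_lower w) (\<lambda>b. lp_tangent M u (\<Phi> (restrict b {..<N})))"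
proof
  note coord = real_multilinear_coordinate[OF \<Phi>]
  fix b :: "nat \<Rightarrow> nat \<Rightarrow> 'a" and j and x y :: "nat \<Rightarrow> 'a" and c :: real
  assume b: "\<And>k. k < N \<Longrightarrow> b k \<in> d_lower w" and j: "j < N" and x: "x \<in> d_lower w"
  have mem: "\<Phi> (restrict (b(j := z)) {..<N}) \<in> lp_space M" if "z \<in> d_lower w" for z
    by (rule multilinear_on_mem[OF \<Phi>]) (use b that in auto)
  have "\<Phi> (restrict (b(j := (\<lambda>i. of_real c * x i))) {..<N})
      = (\<lambda>i. of_real c * \<Phi> (restrict (b(j := x)) {..<N}) i)"
    using real_multilinear.scale[OF coord b j x] by (auto simp: scaleR_conv_of_real)
  then show "lp_tangent M u (\<Phi> (restrict (b(j := (\<lambda>i. of_real c * x i))) {..<N}))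
      = c *\<^sub>R lp_tangent M u (\<Phi> (restrict (b(j := x)) {..<N}))"
    using lp_tangent_scale[OF M u mem[OF x]] by simp
  show "lp_tangent M u (\<Phi> (restrict (b(j := (\<lambda>i. x i + y i))) {..<N}))
      = lp_tangent M u (\<Phi> (restrict (b(j := x)) {..<N})) + lp_tangent M u (\<Phi> (restrict (b(j := y)) {..<N}))"
    if y: "y \<in> d_lower w"
  proof -
    have "\<Phi> (restrict (b(j := (\<lambda>i. x i + y i))) {..<N})
        = (\<lambda>i. \<Phi> (restrict (b(j := x)) {..<N}) i + \<Phi> (restrict (b(j := y)) {..<N}) i)"
      using real_multilinear.add[OF coord b j x y] by auto
    then show ?thesis
      using lp_tangent_add[OF M u mem[OF x] mem[OF y]] by simp
  qed
next
  fix b b' :: "nat \<Rightarrow> nat \<Rightarrow> 'a"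
  assume "\<And>j. j < N \<Longrightarrow> b j = b' j"
  then have "restrict b {..<N} = restrict b' {..<N}"
    by (auto simp: restrict_def)
  then show "lp_tangent M u (\<Phi> (restrict b {..<N})) = lp_tangent M u (\<Phi> (restrict b' {..<N}))" by simp
qed (auto intro: d_lower_0 d_lower_add d_lower_mult)

text \<open>Continuity at the zero tuple bounds the map on a ball of radius d; scaling every slot by
  d/2 and homogeneity transfer the bound to the unit ball.\<close>

lemma bounded_on_unit_ball:
  fixes \<Phi> :: "(nat \<Rightarrow> nat \<Rightarrow> 'a::real_normed_field) \<Rightarrow> nat \<Rightarrow> 'a"
  assumes \<Phi>: "multilinear_on N (d_lower w) (lp_space M) \<Phi>"
    and cont: "continuous_multi_on N (d_lower w) (norm_W w) (lp_norm M) \<Phi>"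
    and N: "1 \<le> N" and M: "1 \<le> M"
  shows "\<exists>C. \<forall>b. (\<forall>k<N. b k \<in> unit_ball (d_lower w) (norm_W w)) \<longrightarrow>
    lp_sum M (\<Phi> (restrict b {..<N})) \<le> C"
proof -
  define b0 :: "nat \<Rightarrow> nat \<Rightarrow> 'a" where "b0 = restrict (\<lambda>_ _. 0) {..<N}"
  have b0: "b0 \<in> {..<N} \<rightarrow>\<^sub>E d_lower w"
    by (auto simp: b0_def d_lower_0)
  obtain d where d: "0 < d" "\<And>b. b \<in> {..<N} \<rightarrow>\<^sub>E d_lower w \<Longrightarrow> \<forall>j<N. norm_W w (\<lambda>i. b j i - b0 j i) < d \<Longrightarrow>
      lp_norm M (\<lambda>i. \<Phi> b i - \<Phi> b0 i) < 1"
    using cont b0 unfolding continuous_multi_on_def by (meson zero_less_one)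
  note hom = real_multilinear.homogeneous[OF real_multilinear_coordinate[OF \<Phi>]]
  \<comment> \<open>As N >= 1, the zero tuple is sent to 0, so the difference in the continuity
    condition is the value itself.\<close>
  have \<Phi>b0: "\<Phi> b0 i = 0" for i
    using hom[of "\<lambda>_ _. 0" 0 i] N by (simp add: b0_def d_lower_0 power_0_left)
  define C where "C = norm (of_real ((2 / d) ^ N) :: 'a) ^ M"
  have "lp_sum M (\<Phi> (restrict b {..<N})) \<le> C"
    if b: "\<forall>k<N. b k \<in> unit_ball (d_lower w) (norm_W w)" for b
  proof -
    have bX: "b k \<in> d_lower w" "norm_W w (b k) \<le> 1" if "k < N" for k
      using b that by (auto simp: unit_ball_def)
    define b' where "b' = (\<lambda>k i. of_real (d / 2) * b k i)"
    have b'X: "b' k \<in> d_lower w" if "k < N" for k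
      unfolding b'_def by (rule d_lower_mult[OF bX(1)[OF that]])
    then have b'E: "restrict b' {..<N} \<in> {..<N} \<rightarrow>\<^sub>E d_lower w"
      by auto
    have mem: "\<Phi> (restrict b {..<N}) \<in> lp_space M" "\<Phi> (restrict b' {..<N}) \<in> lp_space M"
      using multilinear_on_mem[OF \<Phi>] bX(1) b'X by auto
    have "norm_W w (\<lambda>i. restrict b' {..<N} j i - b0 j i) < d" if "j < N" for j
    proof -
      have "norm_W w (b' j) \<le> norm (of_real (d / 2) :: 'a) * 1"
        unfolding b'_def by (rule norm_W_mult_le[OF bX[OF that]])
      then show ?thesis
        using d(1) that by (simp add: b0_def)
    qed
    then have "lp_norm M (\<lambda>i. \<Phi> (restrict b' {..<N}) i - \<Phi> b0 i) < 1"
      using d(2)[OF b'E] by blast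
    then have le1: "lp_sum M (\<Phi> (restrict b' {..<N})) \<le> 1"
      using lp_norm_less_iff[OF M _ mem(2), of 1] by (simp add: \<Phi>b0)
    have "(2 / d) ^ N * (d / 2) ^ N = 1"
      using d(1) by (simp flip: power_mult_distrib)
    then have "of_real ((2 / d) ^ N) * \<Phi> (restrict b' {..<N}) i = \<Phi> (restrict b {..<N}) i" for i
      unfolding b'_def by (subst hom[OF bX(1)])
        (simp_all only: scaleR_conv_of_real mult.assoc[symmetric] of_real_mult[symmetric] of_real_1 mult_1_left)
    then have "lp_sum M (\<Phi> (restrict b {..<N})) = C * lp_sum M (\<Phi> (restrict b' {..<N}))"
      using lp_space_mult(2)[OF mem(2), of "of_real ((2 / d) ^ N)"] by (simp add: C_def)
    also have "\<dots> \<le> C * 1"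
      using le1 by (intro mult_left_mono) (auto simp: C_def)
    finally show ?thesis by simp
  qed
  then show ?thesis by blast
qed

section \<open>Signed weight vectors and decay of multilinear forms\<close>

text \<open>A set of n + 1 indices has maximum at least n, so removing the maximum removes a weight
  of at most \<open>w n\<close>.\<close>

lemma sum_w_le_W:
  assumes "finite L"
  shows "sum w L \<le> W w (card L)"
  using assms
proof (induction "card L" arbitrary: L)
  case (Suc n)
  have L: "L \<noteq> {}" using Suc by auto
  have "L \<subseteq> {..Max L}"
    using Suc.prems by auto
  then have "card L \<le> Suc (Max L)"
    using card_mono[of "{..Max L}" L] by simp
  then have "w (Max L) \<le> w n"
    using Suc.hyps(2) by (intro decseqD[OF decseq_w]) simp
  moreover have "card (L - {Max L}) = n"
    using Suc L by simp
  then have "sum w (L - {Max L}) \<le> W w n"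
    using Suc.hyps(1)[of "L - {Max L}"] Suc.prems by simp
  ultimately show ?case
    using Suc.prems L sum.remove[of L "Max L" w] by (simp add: W_Suc flip: Suc.hyps(2))
qed simp

text \<open>Moving the weights to other positions and changing signs leaves the sums over finite
  sets below W. These are the signed sums required by \<open>sum_diagonal_le\<close>.\<close>

lemma signed_sum_in_unit_ball:
  fixes s :: "nat \<Rightarrow> real"
  assumes r: "inj r" and s: "\<And>l. \<bar>s l\<bar> = 1"
  shows "(\<lambda>i. \<Sum>l<m. of_real (s l) * (of_real (w l) * unit_seq (r l) i) :: 'a::real_normed_field)
    \<in> unit_ball (d_lower w) (norm_W w)"
  unfolding unit_ball_iff
proof (intro conjI allI impI)
  let ?x = "\<lambda>i. \<Sum>l<m. of_real (s l) * (of_real (w l) * unit_seq (r l) i) :: 'a"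
  have "?x i = 0" if "i \<notin> r ` {..<m}" for i
    using that by (intro sum.neutral) auto
  then have "{i. ?x i \<noteq> 0} \<subseteq> r ` {..<m}"
    by blast
  then show "?x \<in> d_lower w"
    by (rule d_lower_finite_support[OF finite_subset]) simp
  fix A :: "nat set" assume A: "finite A"
  define L where "L = {l. l < m \<and> r l \<in> A}"
  have "(\<Sum>i\<in>A. norm (?x i)) \<le> (\<Sum>i\<in>A. \<Sum>l<m. if i = r l then w l else 0)"
  proof (intro sum_mono order_trans[OF norm_sum])
    fix i l
    show "norm (of_real (s l) * (of_real (w l) * unit_seq (r l) i) :: 'a) \<le> (if i = r l then w l else 0)"
      using s[of l] w_nonneg[of l] by (simp add: norm_mult)
  qed
  also have "\<dots> = (\<Sum>l<m. if r l \<in> A then w l else 0)"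
    using A by (subst sum.swap) simp
  also have "\<dots> = sum w L"
    unfolding L_def by (subst sum.inter_filter[symmetric]) (auto intro!: sum.cong)
  also have "\<dots> \<le> W w (card L)"
    by (rule sum_w_le_W) (simp add: L_def)
  also have "\<dots> \<le> W w (card A)"
    using A r by (intro W_mono card_inj_on_le[of r]) (auto simp: L_def inj_on_def)
  finally show "(\<Sum>i\<in>A. norm (?x i)) \<le> W w (card A)" .
qed

lemma unit_seq_in_d_lower: "unit_seq n \<in> d_lower w"
  by (rule d_lower_finite_support) simp

lemma unit_seq_in_unit_ball: "(unit_seq n :: nat \<Rightarrow> 'a::real_normed_field) \<in> unit_ball (d_lower w) (norm_W w)"
proof -
  have "inj (\<lambda>l. n + l)" by (simp add: inj_def)
  from signed_sum_in_unit_ball[OF this, of "\<lambda>_. 1" 1, where ?'a = 'a] show ?thesis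
    by (simp add: w_0)
qed

text \<open>Otherwise the form stays above some c along an injective sequence r of indices. Placing
  the vectors w l times the unit vector at r l in all slots of S makes the l-th diagonal value at
  least c times w l to the power card S, while the diagonal sum stays bounded by C.\<close>

lemma multilinear_form_tendsto_0:
  fixes G :: "(nat \<Rightarrow> nat \<Rightarrow> 'a::real_normed_field) \<Rightarrow> real"
  assumes G: "real_multilinear N (d_lower w) G"
    and C: "\<And>b. (\<And>k. k < N \<Longrightarrow> b k \<in> unit_ball (d_lower w) (norm_W w)) \<Longrightarrow> \<bar>G b\<bar> \<le> C"
    and a: "a \<in> unit_ball (d_lower w) (norm_W w)"
    and S: "S \<noteq> {}" "S \<subseteq> {..<N}" "w \<notin> lp_space (card S)"
  shows "(\<lambda>n. G (\<lambda>k. if k \<in> S then unit_seq n else a)) \<longlonglongrightarrow> 0"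
proof (rule ccontr)
  let ?G = "\<lambda>n. G (\<lambda>k. if k \<in> S then unit_seq n else a)"
  assume "\<not> ?G \<longlonglongrightarrow> 0"
  then obtain c where c: "0 < c" and inf: "infinite {i. c \<le> norm (?G i)}"
    using infinite_levels_if_not_tendsto_0 by blast
  obtain r :: "nat \<Rightarrow> nat" where r: "inj r" "range r \<subseteq> {i. c \<le> norm (?G i)}"
    using infinite_countable_subset[OF inf] by blast
  have fin: "finite S" using S(2) finite_subset by blast
  have aX: "a \<in> d_lower w" using a by (simp add: unit_ball_def)
  define f where "f l = (\<lambda>i. of_real (w l) * unit_seq (r l) i :: 'a)" for l
  have fX: "f l \<in> d_lower w" for l
    unfolding f_def by (intro d_lower_mult unit_seq_in_d_lower)
  have Gf: "G (\<lambda>k. if k \<in> S then f l else a) = w l ^ card S * ?G (r l)" for l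
  proof -
    have "G (\<lambda>j. if j \<in> S then (\<lambda>i. of_real (w l) * (if j \<in> S then unit_seq (r l) else a) i)
        else (if j \<in> S then unit_seq (r l) else a)) = w l ^ card S *\<^sub>R ?G (r l)"
      by (rule real_multilinear.homogeneous_on[OF G _ fin S(2)]) (simp add: aX unit_seq_in_d_lower)
    moreover have "(\<lambda>j. if j \<in> S then (\<lambda>i. of_real (w l) * (if j \<in> S then unit_seq (r l) else a) i)
        else (if j \<in> S then unit_seq (r l) else a)) = (\<lambda>k. if k \<in> S then f l else a)"
      by (auto simp: f_def)
    ultimately show ?thesis by simp
  qed
  have "(\<Sum>l<m. w l ^ card S) \<le> C / c" for m
  proof -
    have "(\<Sum>l<m. \<bar>G (\<lambda>k. if k \<in> S then f l else a)\<bar>) \<le> C"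
    proof (rule sum_diagonal_le[OF G _ C])
      show "(\<lambda>i. \<Sum>l<m. of_real (s l) * f l i) \<in> unit_ball (d_lower w) (norm_W w)"
        if "\<And>l. \<bar>s l\<bar> = 1" for s
        unfolding f_def by (rule signed_sum_in_unit_ball[OF r(1) that])
    qed (use fX S fin a in \<open>auto simp: unit_ball_def\<close>)
    moreover have "c * (\<Sum>l<m. w l ^ card S) \<le> (\<Sum>l<m. \<bar>G (\<lambda>k. if k \<in> S then f l else a)\<bar>)"
      unfolding sum_distrib_left
    proof (rule sum_mono)
      fix l
      have "c \<le> \<bar>?G (r l)\<bar>" using subsetD[OF r(2) rangeI[of r l]] by simp
      then have "w l ^ card S * c \<le> w l ^ card S * \<bar>?G (r l)\<bar>"
        by (intro mult_left_mono) (simp_all add: w_nonneg)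
      then show "c * w l ^ card S \<le> \<bar>G (\<lambda>k. if k \<in> S then f l else a)\<bar>"
        by (simp add: Gf abs_mult w_nonneg mult.commute)
    qed
    ultimately show ?thesis
      using c by (simp add: field_simps)
  qed
  note le = this
  have "summable (\<lambda>l. w l ^ card S)"
    by (rule bounded_imp_summable[of _ "C / c"])
      (simp add: w_nonneg, simp only: le flip: lessThan_Suc_atMost)
  then show False
    using S(3) by (simp add: lp_space_def w_nonneg)
qed

end

section \<open>Homogeneous polynomials\<close>

lemma prod_continuous_coordinates:
  fixes a :: "nat \<Rightarrow> 'a::real_normed_field"
  assumes "0 < e"
  shows "\<exists>d>0. \<forall>b. (\<forall>j<n. norm (b j - a j) < d) \<longrightarrow> norm ((\<Prod>j<n. b j) - (\<Prod>j<n. a j)) < e"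
  using assms
proof (induction n arbitrary: e)
  case 0
  then show ?case by (auto intro!: exI[of _ 1])
next
  case (Suc n)
  define p where "p b = (\<Prod>j<n. b j)" for b :: "nat \<Rightarrow> 'a"
  \<comment> \<open>The total factor of \<open>e'\<close> after splitting the difference of
    products; the summand 1 comes from the product of the two small differences, one of which is at
    most 1.\<close>
  define A where "A = norm (p a) + norm (a n) + 1"
  have A: "1 \<le> A" by (simp add: A_def)
  define e' where "e' = min 1 (e / (2 * A))"
  have e': "0 < e'" "e' \<le> 1" "A * e' \<le> e / 2"
    using Suc.prems A by (auto simp: e'_def min_def field_simps)
  obtain d where d: "0 < d" "\<And>b. \<forall>j<n. norm (b j - a j) < d \<Longrightarrow> norm (p b - p a) < e'"
    using Suc.IH[OF e'(1)] unfolding p_def by blast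
  have "norm (p b * b n - p a * a n) < e"
    if b: "\<And>j. j < Suc n \<Longrightarrow> norm (b j - a j) < min d e'" for b
  proof -
    have 1: "norm (p b - p a) < e'"
      using b by (intro d(2)) auto
    have 2: "norm (b n - a n) < e'"
      using b[of n] by simp
    have "p b * b n - p a * a n = (p b - p a) * (b n - a n) + (p b - p a) * a n + p a * (b n - a n)"
      by (simp add: algebra_simps)
    then have "norm (p b * b n - p a * a n)
        \<le> norm ((p b - p a) * (b n - a n)) + norm ((p b - p a) * a n) + norm (p a * (b n - a n))"
      by (metis norm_triangle_le norm_triangle_ineq add_right_mono)
    also have "\<dots> \<le> e' * 1 + e' * norm (a n) + norm (p a) * e'"
      unfolding norm_mult using 1 2 e'(1,2) by (intro add_mono mult_mono) auto
    also have "\<dots> = A * e'"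
      by (simp add: A_def algebra_simps)
    finally show ?thesis
      using e'(3) Suc.prems by linarith
  qed
  then show ?case
    using d(1) e'(1) by (intro exI[of _ "min d e'"]) (auto simp: p_def)
qed

lemma sum_linear_polynomial:
  fixes A B :: "'v::real_vector"
  assumes "1 \<le> N"
  shows "(\<Sum>k\<le>N. t ^ k *\<^sub>R (if k = 0 then A else if k = 1 then B else 0)) = A + t *\<^sub>R B"
proof -
  have "(\<Sum>k\<le>N. t ^ k *\<^sub>R (if k = 0 then A else if k = 1 then B else 0))
      = (\<Sum>k\<in>{0, 1}. t ^ k *\<^sub>R (if k = 0 then A else if k = 1 then B else 0))"
    using assms by (intro sum.mono_neutral_right) auto
  then show ?thesis by simp
qed

context admissible_weight
begin

text \<open>The inclusion into l_M, raised to degree N by a power of coordinate 0. Along a unit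
  vector of index n >= 1 that power is constant, so the polynomial stays affine in t.\<close>

definition shift_poly :: "nat \<Rightarrow> (nat \<Rightarrow> 'a::real_normed_field) \<Rightarrow> nat \<Rightarrow> 'a" where
  "shift_poly N = (\<lambda>x\<in>d_lower w. \<lambda>i. x 0 ^ (N - 1) * x i)"

lemma shift_poly_in_hom_polys:
  assumes N: "1 \<le> N" and M: "1 \<le> M" "w \<in> lp_space M"
  shows "(shift_poly N :: (nat \<Rightarrow> 'a::real_normed_field) \<Rightarrow> nat \<Rightarrow> 'a)
    \<in> hom_polys N (d_lower w) (norm_W w) (lp_space M) (lp_norm M)"
proof -
  obtain m where Nm: "N = Suc m"
    using N by (cases N) auto
  define \<Phi> :: "(nat \<Rightarrow> nat \<Rightarrow> 'a) \<Rightarrow> nat \<Rightarrow> 'a" where "\<Phi> b = (\<lambda>i. (\<Prod>j<m. b j 0) * b m i)" for b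
  have lp: "x \<in> lp_space M" if "x \<in> d_lower w" for x :: "nat \<Rightarrow> 'a"
    by (rule d_lower_lp_space(1)[OF M(2) that order_refl])
  have upd: "\<Phi> (b(j := z)) = (\<lambda>i. if j = m then (\<Prod>j<m. b j 0) * z i else (\<Prod>k\<in>{..<m} - {j}. b k 0) * z 0 * b m i)"
    if "j < N" for b j z
  proof (cases "j = m")
    case False
    then have j: "j \<in> {..<m}" using that Nm by simp
    have "(\<Prod>k\<in>{..<m} - {j}. (b(j := z)) k 0) = (\<Prod>k\<in>{..<m} - {j}. b k 0)"
      by (intro prod.cong) auto
    then show ?thesis
      using False prod.remove[OF _ j, of "\<lambda>k. (b(j := z)) k 0"] by (simp add: \<Phi>_def mult_ac)
  next
    case True
    have "(\<Prod>k<m. (b(m := z)) k 0) = (\<Prod>k<m. b k 0)"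
      by (intro prod.cong) auto
    then show ?thesis using True by (simp add: \<Phi>_def)
  qed
  have ml: "multilinear_on N (d_lower w) (lp_space M) \<Phi>"
    unfolding multilinear_on_def
  proof (intro conjI ballI allI impI)
    show "\<Phi> \<in> ({..<N} \<rightarrow>\<^sub>E d_lower w) \<rightarrow> lp_space M"
    proof
      fix b :: "nat \<Rightarrow> nat \<Rightarrow> 'a" assume "b \<in> {..<N} \<rightarrow>\<^sub>E d_lower w"
      then have "b m \<in> d_lower w" using Nm by auto
      then show "\<Phi> b \<in> lp_space M"
        unfolding \<Phi>_def by (intro lp_space_mult lp)
    qed
  next
    fix a :: "nat \<Rightarrow> nat \<Rightarrow> 'a" and j and u v :: "nat \<Rightarrow> 'a" assume "j < N"
    then show "\<Phi> (a(j := (\<lambda>i. u i + v i))) = (\<lambda>i. \<Phi> (a(j := u)) i + \<Phi> (a(j := v)) i)"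
      unfolding upd[OF \<open>j < N\<close>] by (simp add: algebra_simps fun_eq_iff)
  next
    fix a :: "nat \<Rightarrow> nat \<Rightarrow> 'a" and j c and u :: "nat \<Rightarrow> 'a" assume "j < N"
    then show "\<Phi> (a(j := (\<lambda>i. c * u i))) = (\<lambda>i. c * \<Phi> (a(j := u)) i)"
      unfolding upd[OF \<open>j < N\<close>] by (simp add: fun_eq_iff)
  qed
  have cont: "continuous_multi_on N (d_lower w) (norm_W w) (lp_norm M) \<Phi>"
    unfolding continuous_multi_on_def
  proof (intro ballI allI impI)
    fix a :: "nat \<Rightarrow> nat \<Rightarrow> 'a" and e :: real assume a: "a \<in> {..<N} \<rightarrow>\<^sub>E d_lower w" and e: "0 < e"
    have aX: "a j \<in> d_lower w" if "j < N" for j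
      using a that by auto
    define p where "p b = (\<Prod>j<m. b j 0)" for b :: "nat \<Rightarrow> nat \<Rightarrow> 'a"
    define C where "C = lp_sum M w"
    have C: "0 \<le> C" unfolding C_def by (rule lp_sum_nonneg[OF M(2)])
    define R where "R = norm_W w (a m) + 1"
    have R: "0 \<le> R" unfolding R_def using norm_W_nonneg[OF aX[of m]] Nm by simp
    \<comment> \<open>Collects the constants in the split of the difference into (p b - p a) b m and
      p a (b m - a m). Both increments are at most q, so the total is at most H q^M; q <= 1 then
      gives H q^M <= H q.\<close>
    define H where "H = 2 ^ M * (R ^ M * C + norm (p a) ^ M * C)"
    have H: "0 \<le> H" unfolding H_def using C R by simp
    define q where "q = min 1 (e ^ M / (2 * (H + 1)))"
    have q: "0 < q" "q \<le> 1" "H * q < e ^ M"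
    proof -
      have "H * q \<le> H * (e ^ M / (2 * (H + 1)))"
        using H by (intro mult_left_mono) (auto simp: q_def)
      also have "\<dots> < e ^ M"
        using H e by (simp add: field_simps) (smt (verit) mult_nonneg_nonneg zero_less_power)
      finally show "H * q < e ^ M" .
    qed (use H e in \<open>auto simp: q_def\<close>)
    obtain d where d: "0 < d"
      "\<And>b. \<forall>j<m. norm (b j - a j 0) < d \<Longrightarrow> norm ((\<Prod>j<m. b j) - (\<Prod>j<m. a j 0)) < q"
      using prod_continuous_coordinates[OF q(1), of m "\<lambda>j. a j 0"] by blast
    have "lp_norm M (\<lambda>i. \<Phi> b i - \<Phi> a i) < e"
      if b: "b \<in> {..<N} \<rightarrow>\<^sub>E d_lower w" and close: "\<forall>j<N. norm_W w (\<lambda>i. b j i - a j i) < min d q" for b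
    proof -
      have bX: "b j \<in> d_lower w" if "j < N" for j
        using b that by auto
      have diff: "(\<lambda>i. b j i - a j i) \<in> d_lower w" if "j < N" for j
        by (intro d_lower_diff bX aX that)
      have "norm (b j 0 - a j 0) < d" if "j < m" for j
        using norm_le_norm_W[OF diff[of j], of 0] close that Nm by (metis less_SucI min_less_iff_conj order_le_less_trans)
      then have p: "norm (p b - p a) \<le> q"
        unfolding p_def using d(2)[of "\<lambda>j. b j 0"] by auto
      have m: "m < N" using Nm by simp
      let ?h = "\<lambda>i. b m i - a m i"
      have h: "norm_W w ?h \<le> q"
        using close m by force
      have "norm_W w (b m) \<le> norm_W w (a m) + q"
        using norm_W_add_le[OF aX[OF m] order_refl diff[OF m] h] by simp
      then have bm: "norm_W w (b m) \<le> R"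
        using q(2) by (simp add: R_def)
      have eq: "(\<lambda>i. \<Phi> b i - \<Phi> a i) = (\<lambda>i. (p b - p a) * b m i + p a * ?h i)"
        by (auto simp: \<Phi>_def p_def algebra_simps)
      have mem: "(\<lambda>i. (p b - p a) * b m i) \<in> lp_space M" "(\<lambda>i. p a * ?h i) \<in> lp_space M"
        using lp_space_mult(1)[OF lp[OF bX[OF m]]] lp_space_mult(1)[OF lp[OF diff[OF m]]] by auto
      have "lp_sum M (\<lambda>i. \<Phi> b i - \<Phi> a i)
          \<le> 2 ^ M * (norm (p b - p a) ^ M * lp_sum M (b m) + norm (p a) ^ M * lp_sum M ?h)"
        unfolding eq using lp_space_add(2)[OF mem] lp_space_mult(2)[OF lp[OF bX[OF m]]]
          lp_space_mult(2)[OF lp[OF diff[OF m]]] by simp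
      also have "\<dots> \<le> 2 ^ M * (q ^ M * (R ^ M * C) + norm (p a) ^ M * (q ^ M * C))"
        using p R C q(1) d_lower_lp_space(2)[OF M(2) bX[OF m] bm]
          d_lower_lp_space(2)[OF M(2) diff[OF m] h] lp_sum_nonneg[OF lp[OF bX[OF m]]]
        by (intro mult_left_mono add_mono mult_mono power_mono) (auto simp: C_def)
      also have "\<dots> = H * q ^ M"
        by (simp add: H_def algebra_simps)
      also have "\<dots> \<le> H * q"
        using H q(1,2) M(1) power_decreasing[of 1 M q] by (intro mult_left_mono) auto
      also have "\<dots> < e ^ M" by (rule q(3))
      finally show ?thesis
        using lp_norm_less_iff[OF M(1), of e "\<lambda>i. \<Phi> b i - \<Phi> a i"] e lp_space_add(1)[OF mem]
        unfolding eq by simp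
    qed
    then show "\<exists>d>0. \<forall>b \<in> {..<N} \<rightarrow>\<^sub>E d_lower w.
        (\<forall>j<N. norm_W w (\<lambda>i. b j i - a j i) < d) \<longrightarrow> lp_norm M (\<lambda>i. \<Phi> b i - \<Phi> a i) < e"
      using d(1) q(1) by (intro exI[of _ "min d q"]) auto
  qed
  have "shift_poly N = (\<lambda>x\<in>d_lower w. \<Phi> (\<lambda>j\<in>{..<N}. x))"
    unfolding shift_poly_def \<Phi>_def using Nm by (intro ext) (auto simp: restrict_def)
  with ml cont show ?thesis
    unfolding hom_polys_def by blast
qed

lemma hom_poly_bounded:
  fixes P :: "(nat \<Rightarrow> 'a::real_normed_field) \<Rightarrow> nat \<Rightarrow> 'a"
  assumes P: "P \<in> hom_polys N (d_lower w) (norm_W w) (lp_space M) (lp_norm M)"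
    and N: "1 \<le> N" and M: "1 \<le> M"
  shows "\<exists>C. \<forall>x \<in> unit_ball (d_lower w) (norm_W w). lp_sum M (P x) \<le> C"
    and "x \<in> d_lower w \<Longrightarrow> P x \<in> lp_space M"
    and "x \<in> d_lower w \<Longrightarrow> P (\<lambda>i. of_real c * x i) = (\<lambda>i. of_real (c ^ N) * P x i)"
proof -
  obtain \<Phi> where \<Phi>: "multilinear_on N (d_lower w) (lp_space M) \<Phi>"
    "continuous_multi_on N (d_lower w) (norm_W w) (lp_norm M) \<Phi>"
    and P_eq: "P = (\<lambda>x\<in>d_lower w. \<Phi> (\<lambda>j\<in>{..<N}. x))"
    using P unfolding hom_polys_def by blast
  obtain C where C: "\<And>b. \<forall>k<N. b k \<in> unit_ball (d_lower w) (norm_W w) \<Longrightarrow>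
      lp_sum M (\<Phi> (restrict b {..<N})) \<le> C"
    using bounded_on_unit_ball[OF \<Phi> N M] by blast
  have "lp_sum M (P x) \<le> C" if "x \<in> unit_ball (d_lower w) (norm_W w)" for x
    using C[of "\<lambda>_. x"] that by (simp add: P_eq unit_ball_def)
  then show "\<exists>C. \<forall>x \<in> unit_ball (d_lower w) (norm_W w). lp_sum M (P x) \<le> C" by blast
  show "P x \<in> lp_space M" if x: "x \<in> d_lower w"
    using multilinear_on_mem[OF \<Phi>(1), of "\<lambda>_. x"] x by (simp add: P_eq)
  show "P (\<lambda>i. of_real c * x i) = (\<lambda>i. of_real (c ^ N) * P x i)" if x: "x \<in> d_lower w"
    using real_multilinear.homogeneous[OF real_multilinear_coordinate[OF \<Phi>(1)], of "\<lambda>_. x" c] x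
      d_lower_mult[OF x, of "of_real c"]
    by (auto simp: P_eq scaleR_conv_of_real)
qed

text \<open>\<open>poly_norm\<close> is a supremum of reals, and the bound C ensures that the set is
  bounded above, so the supremum dominates its members.\<close>

lemma lp_norm_le_poly_norm:
  assumes C: "\<And>x. x \<in> unit_ball X nX \<Longrightarrow> lp_sum M (P x) \<le> C" and M: "1 \<le> M"
    and x: "x \<in> unit_ball X nX"
  shows "lp_norm M (P x) \<le> poly_norm X nX (lp_norm M) P"
  unfolding poly_norm_def
proof (rule cSUP_upper[OF x])
  show "bdd_above ((\<lambda>x. lp_norm M (P x)) ` unit_ball X nX)"
    using C M by (intro bdd_aboveI2[of _ _ "root M C"]) (simp add: lp_norm_def lp_sum_def)
qed

end

section \<open>Norm attaining polynomials\<close>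

context admissible_weight
begin

text \<open>Here z n k is the coefficient of t^k along the n-th unit vector, a sum over sets of k
  slots. Composing the multilinear map with \<open>lp_tangent M u\<close> gives a bounded real
  multilinear form, to which the decay lemma applies for each such set.\<close>

lemma hom_poly_expansion:
  fixes P :: "(nat \<Rightarrow> 'a::{real_normed_field, real_inner}) \<Rightarrow> nat \<Rightarrow> 'a"
  assumes P: "P \<in> hom_polys N (d_lower w) (norm_W w) (lp_space M) (lp_norm M)"
    and N: "1 \<le> N" and M: "2 \<le> M" and a: "a \<in> unit_ball (d_lower w) (norm_W w)"
  obtains z where "\<And>n k. z n k \<in> lp_space M"
    and "\<And>n t i. P (\<lambda>i. a i + of_real t * unit_seq n i) i = (\<Sum>k\<le>N. t ^ k *\<^sub>R z n k i)"
    and "\<And>u k. u \<in> lp_space M \<Longrightarrow> 1 \<le> k \<Longrightarrow> w \<notin> lp_space k \<Longrightarrow>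
      (\<lambda>n. lp_tangent M u (z n k)) \<longlonglongrightarrow> 0"
proof -
  have M1: "1 \<le> M" using M by simp
  have aX: "a \<in> d_lower w" using a by (simp add: unit_ball_def)
  obtain \<Phi> where \<Phi>: "multilinear_on N (d_lower w) (lp_space M) \<Phi>"
    "continuous_multi_on N (d_lower w) (norm_W w) (lp_norm M) \<Phi>"
    and P_eq: "P = (\<lambda>x\<in>d_lower w. \<Phi> (\<lambda>j\<in>{..<N}. x))"
    using P unfolding hom_polys_def by blast
  obtain C where C: "\<And>b. \<forall>k<N. b k \<in> unit_ball (d_lower w) (norm_W w) \<Longrightarrow>
      lp_sum M (\<Phi> (restrict b {..<N})) \<le> C"
    using bounded_on_unit_ball[OF \<Phi> N M1] by blast
  define h where "h n S = \<Phi> (restrict (\<lambda>j. if j \<in> S then unit_seq n else a) {..<N})" for n S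
  define z where "z n k = (\<lambda>i. \<Sum>S | S \<subseteq> {..<N} \<and> card S = k. h n S i)" for n k
  have h_lp: "h n S \<in> lp_space M" for n S
    unfolding h_def by (rule multilinear_on_mem[OF \<Phi>(1)]) (simp add: aX unit_seq_in_d_lower)
  show ?thesis
  proof
    show "z n k \<in> lp_space M" for n k
      unfolding z_def by (rule lp_space_sum[OF h_lp M1])
  next
    fix n t i
    have "(\<lambda>i. a i + of_real t * unit_seq n i) \<in> d_lower w"
      by (intro d_lower_add aX d_lower_mult unit_seq_in_d_lower)
    then show "P (\<lambda>i. a i + of_real t * unit_seq n i) i = (\<Sum>k\<le>N. t ^ k *\<^sub>R z n k i)"
      using real_multilinear.expansion[OF real_multilinear_coordinate[OF \<Phi>(1)] aX unit_seq_in_d_lower, of t n i]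
      by (simp add: P_eq z_def h_def)
  next
    fix u :: "nat \<Rightarrow> 'a" and k assume u: "u \<in> lp_space M" and k: "1 \<le> k" "w \<notin> lp_space k"
    have "(\<lambda>n. lp_tangent M u (h n S)) \<longlonglongrightarrow> 0" if S: "S \<subseteq> {..<N}" "card S = k" for S
      unfolding h_def
    proof (rule multilinear_form_tendsto_0[OF real_multilinear_lp_tangent[OF \<Phi>(1) M u] _ a])
      fix b :: "nat \<Rightarrow> nat \<Rightarrow> 'a" assume b: "\<And>k. k < N \<Longrightarrow> b k \<in> unit_ball (d_lower w) (norm_W w)"
      then have "b k \<in> d_lower w" if "k < N" for k
        using that by (simp add: unit_ball_def)
      from lp_tangent_le_sum[OF M u multilinear_on_mem[OF \<Phi>(1) this]]
      show "\<bar>lp_tangent M u (\<Phi> (restrict b {..<N}))\<bar> \<le> lp_sum M u + C"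
        using C[of b] b by force
    qed (use S k in auto)
    then have "(\<lambda>n. \<Sum>S | S \<subseteq> {..<N} \<and> card S = k. lp_tangent M u (h n S)) \<longlonglongrightarrow> 0"
      by (intro tendsto_null_sum) auto
    then show "(\<lambda>n. lp_tangent M u (z n k)) \<longlonglongrightarrow> 0"
      unfolding z_def by (subst lp_tangent_sum[OF M u h_lp])
  qed
qed

text \<open>The point a enters the constants only through the lower bound \<open>\<kappa>\<close>
  and the upper bound \<open>U\<close>, so the smallness conditions on e can be met before Q is
  chosen.\<close>

lemma hom_poly_not_norm_attaining:
  fixes Q :: "(nat \<Rightarrow> 'a::{real_normed_field, real_inner}) \<Rightarrow> nat \<Rightarrow> 'a"
  defines "B \<equiv> unit_ball (d_lower w :: (nat \<Rightarrow> 'a) set) (norm_W w)"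
  assumes Q: "Q \<in> hom_polys N (d_lower w) (norm_W w) (lp_space M) (lp_norm M)"
    and N: "1 \<le> N" and M: "2 \<le> M" and wM: "w \<in> lp_space M"
    and min: "\<And>k. 1 \<le> k \<Longrightarrow> k < M \<Longrightarrow> w \<notin> lp_space k"
    and a: "a \<in> B" and attains: "\<And>x. x \<in> B \<Longrightarrow> lp_sum M (Q x) \<le> lp_sum M (Q a)"
    and close: "\<And>x. x \<in> B \<Longrightarrow> lp_sum M (\<lambda>i. shift_poly N x i - Q x i) \<le> e ^ M"
    and e: "0 < e" and u: "lp_sum M (Q a) + 1 \<le> U"
    and \<kappa>: "0 < \<kappa>" "\<kappa> \<le> norm (a 0) ^ (N - 1)"
    and K: "0 \<le> K" "\<forall>(c::nat \<Rightarrow> 'a) B. (\<forall>t. \<bar>t\<bar> \<le> 1 \<longrightarrow> norm (\<Sum>k\<le>N. t ^ k *\<^sub>R c k) \<le> B) \<longrightarrow>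
      (\<forall>k\<le>N. norm (c k) \<le> K * B)"
    and L: "0 \<le> L" "\<forall>(c::nat \<Rightarrow> real) B. (\<forall>t. \<bar>t\<bar> \<le> 1 \<longrightarrow> norm (\<Sum>k\<le>N. t ^ k *\<^sub>R c k) \<le> B) \<longrightarrow>
      (\<forall>k\<le>N. norm (c k) \<le> L * B)"
    and eK: "real N * K * 2 ^ N * e \<le> \<kappa> / 2"
    and eL: "real M * (real N * L * 2 ^ N * U) * e \<le> (\<kappa> / 2) ^ M / 2 ^ M"
  shows False
proof -
  let ?P = "shift_poly N"
  have M1: "1 \<le> M" using M by simp
  have aX: "a \<in> d_lower w" using a by (simp add: B_def unit_ball_def)
  have P: "?P \<in> hom_polys N (d_lower w) (norm_W w) (lp_space M) (lp_norm M)"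
    by (rule shift_poly_in_hom_polys[OF N M1 wM])
  note P_lp = hom_poly_bounded(2)[OF P N M1] and Q_lp = hom_poly_bounded(2)[OF Q N M1]
  define u where "u = Q a"
  have u_lp: "u \<in> lp_space M" unfolding u_def by (rule Q_lp[OF aX])
  define D where "D x = (\<lambda>i. ?P x i - Q x i)" for x
  have D_lp: "D x \<in> lp_space M" if "x \<in> d_lower w" for x
    unfolding D_def by (intro lp_space_diff P_lp Q_lp that)
  define v where "v n t = (\<lambda>i. a i + of_real t * unit_seq n i)" for n t
  have vX: "v n t \<in> d_lower w" for n t
    unfolding v_def by (intro d_lower_add aX d_lower_mult unit_seq_in_d_lower)
  obtain z where z_lp: "\<And>n k. z n k \<in> lp_space M"
    and z': "\<And>n t i. Q (\<lambda>i. a i + of_real t * unit_seq n i) i = (\<Sum>k\<le>N. t ^ k *\<^sub>R z n k i)"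
    and z_lim': "\<And>u k. u \<in> lp_space M \<Longrightarrow> 1 \<le> k \<Longrightarrow> w \<notin> lp_space k \<Longrightarrow>
      (\<lambda>n. lp_tangent M u (z n k)) \<longlonglongrightarrow> 0"
    by (rule hom_poly_expansion[OF Q N M a[unfolded B_def]]) (rule that)
  note z = z'[folded v_def] and z_lim = z_lim'[OF u_lp _ min]
  \<comment> \<open>For |t| <= 1 the point has norm at most 2; halving it reaches the unit ball, and
    homogeneity of degree N costs the factor 2^N.\<close>
  have D_bound: "lp_sum M (D (v n t)) \<le> (2 ^ N * e) ^ M" if t: "\<bar>t\<bar> \<le> 1" for n t
  proof -
    define x where "x = (\<lambda>i. of_real (1 / 2) * v n t i)"
    have "norm_W w (\<lambda>i. of_real t * unit_seq n i :: 'a) \<le> norm (of_real t :: 'a) * 1"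
      using unit_seq_in_unit_ball[where ?'a = 'a, of n]
      by (intro norm_W_mult_le unit_seq_in_d_lower) (simp add: unit_ball_def)
    then have "norm_W w (v n t) \<le> 1 + 1"
      unfolding v_def using a t
      by (intro norm_W_add_le aX d_lower_mult unit_seq_in_d_lower) (auto simp: B_def unit_ball_def)
    then have "norm_W w x \<le> norm (of_real (1 / 2) :: 'a) * (1 + 1)"
      unfolding x_def by (intro norm_W_mult_le vX)
    moreover have xX: "x \<in> d_lower w"
      unfolding x_def by (intro d_lower_mult vX)
    ultimately have x: "x \<in> B"
      by (simp add: B_def unit_ball_def norm_divide)
    have v: "v n t = (\<lambda>i. of_real 2 * x i)"
      by (simp add: x_def)
    have "D (v n t) = (\<lambda>i. of_real (2 ^ N) * D x i)"
      unfolding v D_def hom_poly_bounded(3)[OF P N M1 xX] hom_poly_bounded(3)[OF Q N M1 xX]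
      by (simp only: right_diff_distrib)
    then have "lp_sum M (D (v n t)) = norm (of_real (2 ^ N) :: 'a) ^ M * lp_sum M (D x)"
      using lp_space_mult(2)[OF D_lp[OF xX], of "of_real (2 ^ N)"] by simp
    also have "\<dots> \<le> (2 ^ N) ^ M * e ^ M"
      using close[OF x] by (intro mult_mono) (auto simp: D_def norm_power lp_sum_nonneg[OF D_lp[OF xX, unfolded D_def]])
    finally show ?thesis by (simp add: power_mult_distrib)
  qed
  \<comment> \<open>The coefficients in t of the shift polynomial at v n t. They are correct only
    for n >= 1, where the perturbation leaves coordinate 0 alone.\<close>
  define p where "p n k = (if k = 0 then (\<lambda>i. a 0 ^ (N - 1) * a i)
      else if k = 1 then (\<lambda>i. a 0 ^ (N - 1) * unit_seq n i) else (\<lambda>i. 0))" for n and k :: nat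
  define d where "d n k = (\<lambda>i. p n k i - z n k i)" for n k
  have p_lp: "p n k \<in> lp_space M" for n k
  proof -
    have "a \<in> lp_space M" "(unit_seq n :: nat \<Rightarrow> 'a) \<in> lp_space M" "(\<lambda>_. 0 :: 'a) \<in> lp_space M"
      using d_lower_lp_space(1)[OF wM _ order_refl] aX unit_seq_in_d_lower d_lower_0 by blast+
    then show ?thesis
      by (simp add: p_def lp_space_mult(1))
  qed
  have d_lp: "d n k \<in> lp_space M" for n k
    unfolding d_def by (intro lp_space_diff p_lp z_lp)
  have D_eq: "D (v n t) i = (\<Sum>k\<le>N. t ^ k *\<^sub>R d n k i)" if n: "1 \<le> n" for n t i
  proof -
    have "(\<Sum>k\<le>N. t ^ k *\<^sub>R p n k i)
        = (\<Sum>k\<le>N. t ^ k *\<^sub>R (if k = 0 then a 0 ^ (N - 1) * a i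
            else if k = 1 then a 0 ^ (N - 1) * unit_seq n i else 0))"
      by (intro sum.cong) (auto simp: p_def)
    also have "\<dots> = ?P (v n t) i"
      unfolding sum_linear_polynomial[OF N] using n vX[of n t]
      by (simp add: shift_poly_def v_def algebra_simps scaleR_conv_of_real)
    finally show ?thesis
      by (simp add: D_def d_def z sum_subtractf scaleR_diff_right)
  qed
  \<comment> \<open>Evaluation at coordinate n turns the bound on D into one for a field-valued
    polynomial in t, hence for its coefficients. The next fact does the same with the tangent
    functional.\<close>
  have d_coord: "norm (d n k n) \<le> K * (2 ^ N * e)" if "1 \<le> n" "k \<le> N" for n k
  proof (rule K(2)[rule_format, of "\<lambda>k. d n k n"])
    fix t :: real assume "\<bar>t\<bar> \<le> 1"
    then have "norm (D (v n t) n) ^ M \<le> (2 ^ N * e) ^ M"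
      by (intro order_trans[OF norm_power_le_lp_sum[OF D_lp[OF vX]] D_bound])
    then have "norm (D (v n t) n) \<le> 2 ^ N * e"
      using e M by (subst (asm) power_mono_iff) auto
    then show "norm (\<Sum>k\<le>N. t ^ k *\<^sub>R d n k n) \<le> 2 ^ N * e"
      using that by (simp add: D_eq)
  qed (rule that)
  have d_tangent: "\<bar>lp_tangent M u (d n k)\<bar> \<le> L * (2 ^ N * e * U)" if "1 \<le> n" "k \<le> N" for n k
  proof -
    have "norm (lp_tangent M u (d n k)) \<le> L * (2 ^ N * e * U)"
    proof (rule L(2)[rule_format, of "\<lambda>k. lp_tangent M u (d n k)"])
      fix t :: real assume t: "\<bar>t\<bar> \<le> 1"
      have "lp_tangent M u (D (v n t)) = (\<Sum>k\<le>N. lp_tangent M u (\<lambda>i. of_real (t ^ k) * d n k i))"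
      proof -
        have "D (v n t) = (\<lambda>i. \<Sum>k\<le>N. of_real (t ^ k) * d n k i)"
          using D_eq[OF that(1)] by (simp add: fun_eq_iff scaleR_conv_of_real)
        then show ?thesis
          using lp_tangent_sum[OF M u_lp lp_space_mult(1)[OF d_lp]] by simp
      qed
      also have "\<dots> = (\<Sum>k\<le>N. t ^ k *\<^sub>R lp_tangent M u (d n k))"
        by (simp add: lp_tangent_scale[OF M u_lp d_lp] del: of_real_power)
      finally have "\<bar>\<Sum>k\<le>N. t ^ k *\<^sub>R lp_tangent M u (d n k)\<bar> \<le> 2 ^ N * e * (lp_sum M u + 1)"
        using lp_tangent_bound[OF M u_lp D_lp[OF vX] D_bound[OF t], of n] e by simp
      also have "\<dots> \<le> 2 ^ N * e * U"
        using e u by (intro mult_left_mono) (auto simp: u_def)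
      finally show "norm (\<Sum>k\<le>N. t ^ k *\<^sub>R lp_tangent M u (d n k)) \<le> 2 ^ N * e * U" by simp
    qed (rule that)
    then show ?thesis by simp
  qed
  define q where "q n k = lp_tangent M u (z n k)" for n k
  have q_high: "\<bar>q n k\<bar> \<le> L * (2 ^ N * e * U)" if "1 \<le> n" "2 \<le> k" "k \<le> N" for n k
  proof -
    have "d n k = (\<lambda>i. of_real (-1) * z n k i)"
      using that by (auto simp: d_def p_def)
    then have "lp_tangent M u (d n k) = - q n k"
      using lp_tangent_scale[OF M u_lp z_lp, of "-1"] by (simp add: q_def)
    then show ?thesis using d_tangent[of n k] that by simp
  qed
  have z0: "z n 0 = u" for n
  proof -
    have "v n 0 = a" by (simp add: v_def)
    then have "u i = (\<Sum>k\<le>N. 0 ^ k *\<^sub>R z n k i)" for i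
      using z[of n 0 i] by (simp add: u_def)
    also have "(\<Sum>k\<le>N. 0 ^ k *\<^sub>R z n k i) = (\<Sum>k\<in>{0}. 0 ^ k *\<^sub>R z n k i)" for i
      by (intro sum.mono_neutral_right) auto
    finally show ?thesis by (auto simp: fun_eq_iff)
  qed
  have split: "{..N} = insert 0 {1..N}" by auto
  \<comment> \<open>Half of the constant that uniform convexity yields; the other half absorbs the
    terms of order k >= M.\<close>
  define \<theta> where "\<theta> = (\<kappa> / 2) ^ M / 2 ^ M"
  have \<theta>: "0 < \<theta>" using \<kappa> by (simp add: \<theta>_def)
  obtain n0 \<delta> where \<delta>: "0 < \<delta>" "\<delta> \<le> 1"
    and ball: "\<And>n c. \<lbrakk>n0 \<le> n; norm c \<le> \<delta>\<rbrakk> \<Longrightarrow> (\<lambda>i. a i + c * unit_seq n i) \<in> B"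
    by (rule unit_ball_perturbation[OF a[unfolded B_def], folded B_def]) (rule that)
  have main: "\<theta> * \<delta> ^ M \<le> real M * (\<Sum>k\<in>{1..<min (Suc N) M}. \<delta> ^ k * \<bar>q n k\<bar>)"
    if n: "n0 \<le> n" "1 \<le> n" for n
  proof -
    define y where "y = (\<lambda>i. \<Sum>k\<in>{1..N}. of_real (\<delta> ^ k) * z n k i)"
    have y_lp: "y \<in> lp_space M"
      unfolding y_def by (intro lp_space_sum lp_space_mult(1) z_lp M1)
    have Qv: "Q (v n \<delta>) = (\<lambda>i. u i + y i)"
      unfolding y_def split fun_eq_iff z by (simp add: split z0 scaleR_conv_of_real)
    have "v n \<delta> \<in> B"
      unfolding v_def using n \<delta> by (intro ball) auto
    then have "lp_sum M (\<lambda>i. u i + y i) \<le> lp_sum M u"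
      using attains[of "v n \<delta>"] by (simp add: Qv u_def)
    then have neg: "real M * lp_tangent M u y + 2 / 2 ^ M * lp_sum M y \<le> 0"
      using lp_sum_uniformly_convex[OF M u_lp y_lp] by linarith
    \<comment> \<open>At coordinate n the shift polynomial moves by at least
      \<open>\<delta> * \<kappa>\<close>. The correction from Q has only terms with k >= 1, so it
      too is proportional to \<open>\<delta>\<close>, and \<open>eK\<close> makes it at most half as
      large.\<close>
    have "\<delta> * (\<kappa> / 2) \<le> norm (y n)"
    proof -
      have "D (v n \<delta>) n = d n 0 n + (\<Sum>k\<in>{1..N}. \<delta> ^ k *\<^sub>R d n k n)"
        unfolding D_eq[OF n(2)] by (simp add: split)
      moreover have "D (v n \<delta>) n = a 0 ^ (N - 1) * (a n + of_real \<delta>) - (u n + y n)"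
        unfolding D_def Qv using vX[of n \<delta>] n by (simp add: shift_poly_def v_def)
      moreover have "d n 0 n = a 0 ^ (N - 1) * a n - u n"
        by (simp add: d_def p_def z0)
      ultimately have y: "y n = a 0 ^ (N - 1) * of_real \<delta> - (\<Sum>k\<in>{1..N}. \<delta> ^ k *\<^sub>R d n k n)"
        by (simp add: algebra_simps)
      have "norm (\<Sum>k\<in>{1..N}. \<delta> ^ k *\<^sub>R d n k n) \<le> (\<Sum>k\<in>{1..N}. \<delta> * (K * (2 ^ N * e)))"
      proof (rule sum_norm_le)
        fix k assume k: "k \<in> {1..N}"
        then have "\<delta> ^ k \<le> \<delta> ^ 1"
          using \<delta> by (intro power_decreasing) auto
        then show "norm (\<delta> ^ k *\<^sub>R d n k n) \<le> \<delta> * (K * (2 ^ N * e))"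
          using \<delta> d_coord[OF n(2), of k] k by (auto intro!: mult_mono)
      qed
      also have "\<dots> = \<delta> * (real N * K * 2 ^ N * e)"
        by simp
      also have "\<dots> \<le> \<delta> * (\<kappa> / 2)"
        using \<delta> eK by (intro mult_left_mono) auto
      finally have 1: "norm (\<Sum>k\<in>{1..N}. \<delta> ^ k *\<^sub>R d n k n) \<le> \<delta> * (\<kappa> / 2)" .
      have "\<delta> * \<kappa> \<le> norm (a 0 ^ (N - 1) * of_real \<delta>)"
        using \<delta> \<kappa> by (simp add: norm_mult norm_power mult.commute mult_left_mono)
      with 1 show ?thesis
        unfolding y using norm_triangle_ineq2[of "a 0 ^ (N - 1) * of_real \<delta>" "\<Sum>k\<in>{1..N}. \<delta> ^ k *\<^sub>R d n k n"]
        by (simp add: field_simps)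
    qed
    then have "(\<delta> * (\<kappa> / 2)) ^ M \<le> norm (y n) ^ M"
      using \<delta> \<kappa> by (intro power_mono) auto
    also have "\<dots> \<le> lp_sum M y"
      by (rule norm_power_le_lp_sum[OF y_lp])
    finally have "2 / 2 ^ M * (\<delta> * (\<kappa> / 2)) ^ M \<le> 2 / 2 ^ M * lp_sum M y"
      by (intro mult_left_mono) auto
    then have "2 * \<theta> * \<delta> ^ M \<le> 2 / 2 ^ M * lp_sum M y"
      unfolding \<theta>_def power_mult_distrib[of \<delta>] by (simp add: mult_ac)
    with neg have neg': "2 * \<theta> * \<delta> ^ M \<le> real M * - lp_tangent M u y"
      by simp
    have "- lp_tangent M u y \<le> (\<Sum>k\<in>{1..N}. \<delta> ^ k * \<bar>q n k\<bar>)"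
    proof -
      have "lp_tangent M u y = (\<Sum>k\<in>{1..N}. lp_tangent M u (\<lambda>i. of_real (\<delta> ^ k) * z n k i))"
        unfolding y_def by (intro lp_tangent_sum[OF M u_lp] lp_space_mult(1) z_lp)
      also have "\<dots> = (\<Sum>k\<in>{1..N}. \<delta> ^ k * q n k)"
        unfolding q_def by (intro sum.cong refl lp_tangent_scale[OF M u_lp z_lp])
      also have "\<bar>\<dots>\<bar> \<le> (\<Sum>k\<in>{1..N}. \<delta> ^ k * \<bar>q n k\<bar>)"
        using \<delta> by (intro order_trans[OF sum_abs]) (simp add: abs_mult)
      finally show ?thesis by linarith
    qed
    \<comment> \<open>Split at order M; the minimum covers the case N < M, in which the upper part
      is empty.\<close>
    also have "(\<Sum>k\<in>{1..N}. \<delta> ^ k * \<bar>q n k\<bar>)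
        = (\<Sum>k\<in>{1..<min (Suc N) M}. \<delta> ^ k * \<bar>q n k\<bar>) + (\<Sum>k\<in>{M..N}. \<delta> ^ k * \<bar>q n k\<bar>)"
      using M by (subst sum.union_disjoint[symmetric]) (auto intro!: sum.cong)
    also have "(\<Sum>k\<in>{M..N}. \<delta> ^ k * \<bar>q n k\<bar>) \<le> real N * (\<delta> ^ M * (L * (2 ^ N * e * U)))"
    proof -
      have U: "0 \<le> L * (2 ^ N * e * U)"
        using L(1) e u lp_sum_nonneg[OF u_lp] by (simp add: u_def)
      have "(\<Sum>k\<in>{M..N}. \<delta> ^ k * \<bar>q n k\<bar>) \<le> real (card {M..N}) * (\<delta> ^ M * (L * (2 ^ N * e * U)))"
        using \<delta> M n U by (intro sum_bounded_above mult_mono power_decreasing q_high) auto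
      also have "\<dots> \<le> real N * (\<delta> ^ M * (L * (2 ^ N * e * U)))"
        using M \<delta> U by (intro mult_right_mono) auto
      finally show ?thesis .
    qed
    finally have "real M * - lp_tangent M u y \<le> real M * ((\<Sum>k\<in>{1..<min (Suc N) M}. \<delta> ^ k * \<bar>q n k\<bar>)
        + real N * (\<delta> ^ M * (L * (2 ^ N * e * U))))"
      by (intro mult_left_mono) auto
    with neg' have "2 * \<theta> * \<delta> ^ M \<le> real M * (\<Sum>k\<in>{1..<min (Suc N) M}. \<delta> ^ k * \<bar>q n k\<bar>)
        + (real M * (real N * L * 2 ^ N * U) * e) * \<delta> ^ M"
      by (simp add: algebra_simps)
    also have "(real M * (real N * L * 2 ^ N * U) * e) * \<delta> ^ M \<le> \<theta> * \<delta> ^ M"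
      using eL \<delta> unfolding \<theta>_def by (intro mult_right_mono) auto
    finally show ?thesis by simp
  qed
  \<comment> \<open>Now n grows with \<open>\<delta>\<close> fixed. Minimality of M makes the decay
    lemma available at every order below M.\<close>
  have "(\<lambda>n. real M * (\<Sum>k\<in>{1..<min (Suc N) M}. \<delta> ^ k * \<bar>q n k\<bar>)) \<longlonglongrightarrow> 0"
    unfolding q_def by (intro tendsto_mult_right_zero tendsto_null_sum tendsto_rabs_zero z_lim) auto
  then have "\<theta> * \<delta> ^ M \<le> 0"
    by (rule LIMSEQ_le_const) (use main in \<open>auto intro!: exI[of _ "max n0 1"]\<close>)
  moreover have "0 < \<theta> * \<delta> ^ M" using \<theta> \<delta> by simp
  ultimately show False by simp
qed

text \<open>All constants are fixed from w, N and M before the approximating Q is taken; it remains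
  to check that any maximizer of Q satisfies the bounds by \<open>U\<close> and
  \<open>\<kappa>\<close>.\<close>

theorem not_na_dense:
  assumes N: "1 \<le> N" and M: "2 \<le> M" and wM: "w \<in> lp_space M"
    and min: "\<And>k. 1 \<le> k \<Longrightarrow> k < M \<Longrightarrow> w \<notin> lp_space k"
  shows "\<not> na_dense N (d_lower w :: (nat \<Rightarrow> 'a::{real_normed_field, real_inner}) set)
    (norm_W w) (lp_space M) (lp_norm M)"
proof
  assume dense: "na_dense N (d_lower w :: (nat \<Rightarrow> 'a) set) (norm_W w) (lp_space M) (lp_norm M)"
  let ?B = "unit_ball (d_lower w :: (nat \<Rightarrow> 'a) set) (norm_W w)"
  let ?P = "shift_poly N :: (nat \<Rightarrow> 'a) \<Rightarrow> nat \<Rightarrow> 'a"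
  have M1: "1 \<le> M" using M by simp
  have P: "?P \<in> hom_polys N (d_lower w) (norm_W w) (lp_space M) (lp_norm M)"
    by (rule shift_poly_in_hom_polys[OF N M1 wM])
  define C where "C = lp_sum M w"
  have C: "1 \<le> C"
    using norm_power_le_lp_sum[OF wM, of 0] by (simp add: C_def w_0)
  define U where "U = 2 ^ M * (C + 1) + 1"
  have U: "1 \<le> U" using C by (simp add: U_def)
  \<comment> \<open>Chosen so that 4^(-M) <= s^M C + e with e at most half of the left side gives
    \<open>\<kappa> \<le> s ^ M\<close>, where s is |a 0|^(N-1).\<close>
  define \<kappa> where "\<kappa> = 1 / (2 * 4 ^ M * C)"
  have \<kappa>: "0 < \<kappa>" using C by (simp add: \<kappa>_def)
  obtain K where K: "0 \<le> K" "\<forall>(c::nat \<Rightarrow> 'a) B.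
      (\<forall>t. \<bar>t\<bar> \<le> 1 \<longrightarrow> norm (\<Sum>k\<le>N. t ^ k *\<^sub>R c k) \<le> B) \<longrightarrow> (\<forall>k\<le>N. norm (c k) \<le> K * B)"
    using coefficients_bounded_by_polynomial[where ?'v = 'a, of N] by blast
  obtain L where L: "0 \<le> L" "\<forall>(c::nat \<Rightarrow> real) B.
      (\<forall>t. \<bar>t\<bar> \<le> 1 \<longrightarrow> norm (\<Sum>k\<le>N. t ^ k *\<^sub>R c k) \<le> B) \<longrightarrow> (\<forall>k\<le>N. norm (c k) \<le> L * B)"
    using coefficients_bounded_by_polynomial[where ?'v = real, of N] by blast
  define A where "A = real N * K * 2 ^ N + real M * (real N * L * 2 ^ N * U) + 1"
  have A: "real N * K * 2 ^ N \<le> A" "real M * (real N * L * 2 ^ N * U) \<le> A" "1 \<le> A"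
    using K(1) L(1) U by (auto simp: A_def)
  \<comment> \<open>In order, the bounds serve to keep Q at the unit vector of index 0 above 1/2, to
    derive the lower bound \<open>\<kappa>\<close>, and to meet the two smallness conditions.
    Dividing by \<open>A\<close> clears the factors K and L.\<close>
  define b where "b = min (min (1 / 2) (1 / (2 * 4 ^ M))) (min (\<kappa> / 2) ((\<kappa> / 2) ^ M / 2 ^ M))"
  have b: "b \<le> 1 / 2" "b \<le> 1 / (2 * 4 ^ M)" "b \<le> \<kappa> / 2" "b \<le> (\<kappa> / 2) ^ M / 2 ^ M"
    by (simp_all only: b_def min_le_iff_disj order_refl simp_thms)
  have b0: "0 < b"
    using \<kappa> by (simp add: b_def)
  define e where "e = b / A"
  have e: "0 < e" "A * e = b" "e \<le> b"
    using b0 A(3) by (auto simp: e_def field_simps)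
  obtain Q where Q: "Q \<in> na_hom_polys N (d_lower w) (norm_W w) (lp_space M) (lp_norm M)"
    and PQ: "poly_norm (d_lower w) (norm_W w) (lp_norm M) (\<lambda>x i. ?P x i - Q x i) < e"
    using dense P e(1) unfolding na_dense_def by meson
  then have Qh: "Q \<in> hom_polys N (d_lower w) (norm_W w) (lp_space M) (lp_norm M)"
    by (simp add: na_hom_polys_def)
  obtain a where a: "a \<in> ?B" and Qa: "lp_norm M (Q a) = poly_norm (d_lower w) (norm_W w) (lp_norm M) Q"
    using Q by (auto simp: na_hom_polys_def)
  obtain CP where CP: "\<And>x. x \<in> ?B \<Longrightarrow> lp_sum M (?P x) \<le> CP"
    using hom_poly_bounded(1)[OF P N M1] by blast
  obtain CQ where CQ: "\<And>x. x \<in> ?B \<Longrightarrow> lp_sum M (Q x) \<le> CQ"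
    using hom_poly_bounded(1)[OF Qh N M1] by blast
  have X: "x \<in> d_lower w" if "x \<in> ?B" for x
    using that by (simp add: unit_ball_def)
  have P_lp: "?P x \<in> lp_space M" and Q_lp: "Q x \<in> lp_space M" if "x \<in> ?B" for x
    using hom_poly_bounded(2)[OF P N M1] hom_poly_bounded(2)[OF Qh N M1] X[OF that] by auto
  have attains: "lp_sum M (Q x) \<le> lp_sum M (Q a)" if x: "x \<in> ?B" for x
    using lp_norm_le_poly_norm[where P = Q, OF CQ M1 x] by (simp add: Qa[symmetric] lp_norm_le_lp_norm_iff[OF M1])
  have close: "lp_sum M (\<lambda>i. ?P x i - Q x i) \<le> e ^ M" if x: "x \<in> ?B" for x
  proof -
    have "lp_norm M (\<lambda>i. ?P x i - Q x i)
        \<le> poly_norm (d_lower w) (norm_W w) (lp_norm M) (\<lambda>x i. ?P x i - Q x i)"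
    proof (rule lp_norm_le_poly_norm[where P = "\<lambda>x i. ?P x i - Q x i", OF _ M1 x])
      fix x assume x: "x \<in> ?B"
      show "lp_sum M (\<lambda>i. ?P x i - Q x i) \<le> 2 ^ M * (CP + CQ)"
        using lp_space_diff(2)[OF P_lp[OF x] Q_lp[OF x]] CP[OF x] CQ[OF x]
        by (meson add_mono mult_left_mono order_trans zero_le_numeral zero_le_power)
    qed
    then have "lp_norm M (\<lambda>i. ?P x i - Q x i) \<le> e" using PQ by simp
    then show ?thesis
      using lp_norm_le_iff[OF M1 _ lp_space_diff(1)[OF P_lp[OF x] Q_lp[OF x]]] e(1) by simp
  qed
  have e_pow: "e ^ M \<le> e"
    using e b(1) M1 power_decreasing[of 1 M e] by simp
  define s where "s = norm (a 0) ^ (N - 1)"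
  have "norm (a 0) \<le> 1"
    using norm_le_norm_W[OF X[OF a], of 0] a by (simp add: unit_ball_def)
  then have s: "0 \<le> s" "s \<le> 1"
    by (auto simp: s_def power_le_one)
  have "lp_sum M (?P a) = s ^ M * lp_sum M a"
    using lp_space_mult(2)[OF d_lower_lp_space(1)[OF wM X[OF a] order_refl], of "a 0 ^ (N - 1)"] X[OF a]
    by (simp add: shift_poly_def s_def norm_power)
  also have "\<dots> \<le> s ^ M * C"
    using d_lower_lp_space(2)[OF wM X[OF a], of 1] a s by (intro mult_left_mono) (auto simp: C_def unit_ball_def)
  finally have Pa: "lp_sum M (?P a) \<le> s ^ M * C" .
  have "Q a = (\<lambda>i. ?P a i - (?P a i - Q a i))" by simp
  then have "lp_sum M (Q a) \<le> 2 ^ M * (lp_sum M (?P a) + lp_sum M (\<lambda>i. ?P a i - Q a i))"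
    using lp_space_diff(2)[OF P_lp[OF a] lp_space_diff(1)[OF P_lp[OF a] Q_lp[OF a]]] by simp
  also have "\<dots> \<le> 2 ^ M * (s ^ M * C + e)"
    using Pa close[OF a] e_pow by (intro mult_left_mono) auto
  finally have Qa_le: "lp_sum M (Q a) \<le> 2 ^ M * (s ^ M * C + e)" .
  have "s ^ M * C + e \<le> 1 * C + 1"
    using s C e b by (intro add_mono mult_right_mono power_le_one) auto
  then have "2 ^ M * (s ^ M * C + e) \<le> 2 ^ M * (C + 1)"
    by (intro mult_left_mono) auto
  with Qa_le have Qa_U: "lp_sum M (Q a) + 1 \<le> U"
    unfolding U_def by linarith
  \<comment> \<open>Compare norms: the maximum of Q is at least its value at the unit vector of
    index 0, where the shift polynomial has coordinate 1, while \<open>Qa_le\<close> bounds it by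
    s^M C + e up to the factor 2^M.\<close>
  have \<kappa>_s: "\<kappa> \<le> s"
  proof -
    let ?e = "unit_seq 0 :: nat \<Rightarrow> 'a"
    note e0 = unit_seq_in_unit_ball[where ?'a = 'a, of 0]
    have "norm (?P ?e 0 - Q ?e 0) ^ M \<le> e ^ M"
      by (rule order_trans[OF norm_power_le_lp_sum[OF lp_space_diff(1)[OF P_lp[OF e0] Q_lp[OF e0]]] close[OF e0]])
    then have "norm (?P ?e 0 - Q ?e 0) \<le> e"
      using e(1) M by (subst (asm) power_mono_iff) auto
    moreover have "?P ?e 0 = 1"
      using X[OF e0] by (simp add: shift_poly_def)
    ultimately have "norm (1 - Q ?e 0) \<le> 1 / 2"
      using e b by simp
    then have "1 / 2 \<le> norm (Q ?e 0)"
      using norm_triangle_ineq2[of 1 "1 - Q ?e 0"] by simp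
    then have "(1 / 2) ^ M \<le> norm (Q ?e 0) ^ M"
      by (intro power_mono) auto
    also have "\<dots> \<le> lp_sum M (Q ?e)"
      by (rule norm_power_le_lp_sum[OF Q_lp[OF e0]])
    also have "\<dots> \<le> lp_sum M (Q a)"
      by (rule attains[OF e0])
    also note Qa_le
    finally have "(1 / 2) ^ M / 2 ^ M \<le> s ^ M * C + e"
      by (simp add: field_simps)
    moreover have "(1 / 2) ^ M / 2 ^ M = 1 / (4 ^ M :: real)"
      by (simp add: power_divide flip: power_mult_distrib)
    ultimately have "1 / (2 * 4 ^ M) \<le> s ^ M * C"
      using e b by simp
    then have "\<kappa> \<le> s ^ M"
      using C by (simp add: \<kappa>_def field_simps)
    also have "\<dots> \<le> s"
      using power_decreasing[of 1 M s] M1 s by simp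
    finally show ?thesis .
  qed
  have eK: "real N * K * 2 ^ N * e \<le> \<kappa> / 2"
    using mult_right_mono[OF A(1), of e] e b by simp
  have eL: "real M * (real N * L * 2 ^ N * U) * e \<le> (\<kappa> / 2) ^ M / 2 ^ M"
    using mult_right_mono[OF A(2), of e] e b by simp
  show False
    by (rule hom_poly_not_norm_attaining[OF Qh N M wM min a attains close e(1) Qa_U
      \<kappa> \<kappa>_s[unfolded s_def] K L eK eL])
qed

end

theorem proposition3p4:
  fixes w :: "nat \<Rightarrow> real" and M N :: nat
  assumes "admissible w"
    and "\<exists>m\<ge>1. w \<in> lp_space m"
    and "M = (LEAST m. 1 \<le> m \<and> w \<in> lp_space m)"
    and "1 \<le> N"
  shows "\<not> na_dense N (d_lower w :: (nat \<Rightarrow> real) set) (norm_W w) (lp_space M) (lp_norm M) \<and>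
         \<not> na_dense N (d_lower w :: (nat \<Rightarrow> complex) set) (norm_W w) (lp_space M) (lp_norm M)"
proof -
  interpret admissible_weight w by standard (rule assms(1))
  have M: "1 \<le> M \<and> w \<in> lp_space M"
    unfolding assms(3) by (rule LeastI_ex) (use assms(2) in blast)
  have min: "w \<notin> lp_space k" if "1 \<le> k" "k < M" for k
    using not_less_Least[of k "\<lambda>m. 1 \<le> m \<and> w \<in> lp_space m"] that assms(3) by blast
  \<comment> \<open>Divergence of the weight series excludes exponent 1, which gives M >= 2 as
    uniform convexity requires.\<close>
  have "w \<notin> lp_space 1"
    using not_summable_w by (simp add: lp_space_def w_nonneg)
  with M have "M \<noteq> 1" by metis
  with M have "2 \<le> M" by linarith
  show ?thesis
    by (intro conjI not_na_dense[OF assms(4) \<open>2 \<le> M\<close> conjunct2[OF M]] min)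
qed

end
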